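(* The class of groups with poly-context-free word problem is not closed under quasi-isometries: there exist finitely generated groups $G$ and $H$ that are quasi-isometric, such that $G$ is poly-context-free and $H$ is not poly-context-free.
   Context: Word problem: for a finitely generated group $G$ and a finite symmetric generating set $S=S^{-1}$ of $G$, the word problem is the language $\mathrm{WP}(G,S)=\{w\in S^{*} : w=_G e\}$. A language is poly-context-free if it is an intersection of finitely many context-free languages. A finitely generated group $G$ is poly-context-free (has poly-context-free word problem) if $\mathrm{WP}(G,S)$ is poly-context-free for some (equivalently, every) finite symmetric generating set $S$. Two finitely generated groups are quasi-isometric if their Cayley graphs with respect to finite generating sets are quasi-isometric as metric spaces. *)

theory Defs
  imports "HOL-Algebra.Generated_Groups" "HOL-Analysis.Abstract_Metric_Spaces"
begin

section \<open>Context-free and poly-context-free languages\<close>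

datatype ('n, 't) sym = Nt 'n | Tm 't

type_synonym ('n, 't) syms = "('n, 't) sym list"
type_synonym ('n, 't) prods = "('n \<times> ('n, 't) syms) set"

inductive derive1 :: "('n, 't) prods \<Rightarrow> ('n, 't) syms \<Rightarrow> ('n, 't) syms \<Rightarrow> bool"
  for P where
  "(A, \<alpha>) \<in> P \<Longrightarrow> derive1 P (u @ [Nt A] @ v) (u @ \<alpha> @ v)"

definition lang :: "('n, 't) prods \<Rightarrow> 'n \<Rightarrow> 't list set" where
  "lang P A = {w. (derive1 P)\<^sup>*\<^sup>* [Nt A] (map Tm w)}"

text \<open>A grammar with finitely many productions uses only finitely many nonterminals, so drawing
  the nonterminals from \<^typ>\<open>nat\<close> is no restriction. \<open>\<Sigma>\<close> is the terminal alphabet.\<close>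

definition context_free :: "'t set \<Rightarrow> 't list set \<Rightarrow> bool" where
  "context_free \<Sigma> L \<longleftrightarrow>
     (\<exists>(P :: (nat, 't) prods) A.
        finite P \<and> (\<forall>(B, \<alpha>) \<in> P. \<forall>a. Tm a \<in> set \<alpha> \<longrightarrow> a \<in> \<Sigma>) \<and> L = lang P A)"

definition poly_context_free :: "'t set \<Rightarrow> 't list set \<Rightarrow> bool" where
  "poly_context_free \<Sigma> L \<longleftrightarrow>
     (\<exists>\<K>. finite \<K> \<and> \<K> \<noteq> {} \<and> (\<forall>K \<in> \<K>. context_free \<Sigma> K) \<and> L = \<Inter>\<K>)"

section \<open>Word problems\<close>

definition finite_generating_set :: "('a, 'b) monoid_scheme \<Rightarrow> 'a set \<Rightarrow> bool" where
  "finite_generating_set G S \<longleftrightarrow> finite S \<and> S \<subseteq> carrier G \<and> generate G S = carrier G"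

definition finitely_generated :: "('a, 'b) monoid_scheme \<Rightarrow> bool" where
  "finitely_generated G \<longleftrightarrow> (\<exists>S. finite_generating_set G S)"

definition symmetric_set :: "('a, 'b) monoid_scheme \<Rightarrow> 'a set \<Rightarrow> bool" where
  "symmetric_set G S \<longleftrightarrow> (\<lambda>s. inv\<^bsub>G\<^esub> s) ` S = S"

definition word_value :: "('a, 'b) monoid_scheme \<Rightarrow> 'a list \<Rightarrow> 'a" where
  "word_value G w = foldr (\<lambda>x y. x \<otimes>\<^bsub>G\<^esub> y) w \<one>\<^bsub>G\<^esub>"

definition word_problem :: "('a, 'b) monoid_scheme \<Rightarrow> 'a set \<Rightarrow> 'a list set" where
  "word_problem G S = {w \<in> lists S. word_value G w = \<one>\<^bsub>G\<^esub>}"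

definition poly_context_free_group :: "('a, 'b) monoid_scheme \<Rightarrow> bool" where
  "poly_context_free_group G \<longleftrightarrow>
     (\<exists>S. finite_generating_set G S \<and> symmetric_set G S \<and>
          poly_context_free S (word_problem G S))"

section \<open>Cayley graphs and quasi-isometry\<close>

text \<open>The Cayley graph is taken as an undirected graph, represented by a symmetric edge relation;
  the metric space is its vertex set with the shortest-path distance.\<close>

definition cayley_edges :: "('a, 'b) monoid_scheme \<Rightarrow> 'a set \<Rightarrow> ('a \<times> 'a) set" where
  "cayley_edges G S =
     {(g, h). g \<in> carrier G \<and> h \<in> carrier G \<and> (\<exists>s \<in> S. h = g \<otimes>\<^bsub>G\<^esub> s \<or> g = h \<otimes>\<^bsub>G\<^esub> s)}"

definition cayley_dist :: "('a, 'b) monoid_scheme \<Rightarrow> 'a set \<Rightarrow> 'a \<Rightarrow> 'a \<Rightarrow> real" where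
  "cayley_dist G S g h = real (LEAST n. (g, h) \<in> cayley_edges G S ^^ n)"

definition quasi_isometry ::
  "'a set \<Rightarrow> ('a \<Rightarrow> 'a \<Rightarrow> real) \<Rightarrow> 'b set \<Rightarrow> ('b \<Rightarrow> 'b \<Rightarrow> real) \<Rightarrow> ('a \<Rightarrow> 'b) \<Rightarrow> bool" where
  "quasi_isometry M d N e f \<longleftrightarrow>
     f \<in> M \<rightarrow> N \<and>
     (\<exists>K C. K \<ge> 1 \<and> C \<ge> 0 \<and>
        (\<forall>x \<in> M. \<forall>y \<in> M. d x y / K - C \<le> e (f x) (f y) \<and> e (f x) (f y) \<le> K * d x y + C) \<and>
        (\<forall>z \<in> N. \<exists>x \<in> M. e (f x) z \<le> C))"

definition quasi_isometric_groups ::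
  "('a, 'c) monoid_scheme \<Rightarrow> ('b, 'd) monoid_scheme \<Rightarrow> bool" where
  "quasi_isometric_groups G H \<longleftrightarrow>
     (\<exists>S T. finite_generating_set G S \<and> finite_generating_set H T \<and>
        (\<exists>f. quasi_isometry (carrier G) (cayley_dist G S) (carrier H) (cayley_dist H T) f))"

lemma cayley_edges_sym: "sym (cayley_edges G S)"
  unfolding cayley_edges_def sym_def by blast

lemma cayley_edges_relpow_sym:
  "(g, h) \<in> cayley_edges G S ^^ n \<Longrightarrow> (h, g) \<in> cayley_edges G S ^^ n"
proof (induction n arbitrary: h)
  case (Suc n)
  then obtain k where "(g, k) \<in> cayley_edges G S ^^ n" "(k, h) \<in> cayley_edges G S" by auto
  with Suc.IH show ?case by (metis cayley_edges_sym relpow_Suc_I2 symE)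
qed simp

lemma cayley_edges_connected:
  assumes G: "group G" and S: "S \<subseteq> carrier G" and gen: "generate G S = carrier G"
    and g: "g \<in> carrier G" and h: "h \<in> carrier G"
  shows "\<exists>n. (g, h) \<in> cayley_edges G S ^^ n"
proof -
  interpret group G by fact
  let ?R = "(cayley_edges G S)\<^sup>*"
  have *: "\<forall>x \<in> carrier G. (x, x \<otimes>\<^bsub>G\<^esub> k) \<in> ?R" if "k \<in> generate G S" for k
    using that
  proof (induction k rule: generate.induct)
    case one
    then show ?case by simp
  next
    case (incl k)
    then show ?case using S unfolding cayley_edges_def
      by (intro ballI r_into_rtrancl) auto
  next
    case (inv k)
    then show ?case using S unfolding cayley_edges_def
      by (intro ballI r_into_rtrancl) (auto simp: m_assoc subset_iff intro!: bexI[of _ k])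
  next
    case (eng k l)
    then have "k \<in> carrier G" "l \<in> carrier G" using gen by auto
    then show ?case using eng.IH
      by (metis m_assoc m_closed rtrancl_trans)
  qed
  have "inv\<^bsub>G\<^esub> g \<otimes>\<^bsub>G\<^esub> h \<in> generate G S" using gen g h by simp
  from *[OF this] g h have "(g, h) \<in> ?R" by (metis inv_closed m_assoc r_inv l_one)
  then show ?thesis by (simp add: rtrancl_power)
qed

lemma Metric_space_cayley:
  assumes "group G" and "finite_generating_set G S"
  shows "Metric_space (carrier G) (cayley_dist G S)"
proof
  let ?E = "cayley_edges G S"
  have conn: "\<exists>n. (g, h) \<in> ?E ^^ n" if "g \<in> carrier G" "h \<in> carrier G" for g h
    using cayley_edges_connected[OF assms(1)] assms(2) that
    unfolding finite_generating_set_def by blast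
  fix x y z
  show "0 \<le> cayley_dist G S x y" by (simp add: cayley_dist_def)
  have "((x, y) \<in> ?E ^^ n) = ((y, x) \<in> ?E ^^ n)" for n
    by (blast intro: cayley_edges_relpow_sym)
  then show "cayley_dist G S x y = cayley_dist G S y x"
    by (simp add: cayley_dist_def)
  assume x: "x \<in> carrier G" and y: "y \<in> carrier G"
  note xy = LeastI_ex[OF conn[OF x y]]
  show "(cayley_dist G S x y = 0) = (x = y)"
  proof
    assume "cayley_dist G S x y = 0"
    with xy show "x = y" by (simp add: cayley_dist_def)
  next
    assume "x = y"
    then have "(x, y) \<in> ?E ^^ 0" by simp
    then have "(LEAST n. (x, y) \<in> ?E ^^ n) = 0" by (intro Least_eq_0)
    then show "cayley_dist G S x y = 0" by (simp add: cayley_dist_def)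
  qed
  assume z: "z \<in> carrier G"
  note yz = LeastI_ex[OF conn[OF y z]]
  have "(x, z) \<in> ?E ^^ ((LEAST n. (x, y) \<in> ?E ^^ n) + (LEAST n. (y, z) \<in> ?E ^^ n))"
    unfolding relpow_add using xy yz by blast
  then have "(LEAST n. (x, z) \<in> ?E ^^ n)
      \<le> (LEAST n. (x, y) \<in> ?E ^^ n) + (LEAST n. (y, z) \<in> ?E ^^ n)"
    by (rule Least_le)
  then show "cayley_dist G S x z \<le> cayley_dist G S x y + cayley_dist G S y z"
    unfolding cayley_dist_def by linarith
qed

end

theory Submission
  imports Defs "HOL-Library.Multiset"
begin

text \<open>
  Let \<open>F\<close> be the free product of three copies of the group with two elements, with generating
  involutions \<open>p\<close>, \<open>c\<close>, \<open>d\<close>; its Cayley graph is the trivalent tree. The group \<open>G\<close> is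
  \<open>F \<times> \<int>\<^sup>2\<close>. The group \<open>H\<close> has the same underlying set, but the translations of the plane act
  on the tree, and passing an edge of the tree twists the plane: in \<open>H\<close> one has
  \<open>(i, j) p = p (j, i)\<close>, and \<open>(i, j) c = c (i, i / 2 - j)\<close> when \<open>i\<close> is even, while a translation with
  odd \<open>i\<close> exchanges the edges \<open>c\<close> and \<open>d = (1, 0) c (1, 0)\<^sup>-\<^sup>1\<close>. So \<open>H\<close> is a knit (Zappa-Szep)
  product of \<open>F\<close> and \<open>\<int>\<^sup>2\<close>, described by the letter-to-letter transducer \<open>twist_act\<close>, \<open>twist_res\<close>.

  \<^item> Quasi-isometry. The linear maps \<open>(u, v) \<mapsto> (v, u)\<close> and \<open>(u, v) \<mapsto> (u, u / 2 - v)\<close> preserve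
    the positive definite form \<open>u\<^sup>2 - u v / 2 + v\<^sup>2\<close>. Hence \<open>H\<close> acts by isometries on the
    product of the tree with the euclidean plane, as \<open>G\<close> does, and the map that keeps the tree
    component \<open>f\<close> of an element \<open>(f, z)\<close> and rounds the point to which it moves the origin of the
    plane is a quasi-isometry (\<open>quasi_isometric_knits\<close>).

  \<^item> \<open>G\<close> is poly-context-free. A word represents the identity iff its \<open>F\<close>-part and both of its
    coordinate sums vanish. Each of these three conditions says that a stack machine that cancels
    adjacent inverse letters ends with the empty stack, which is a Dyck-like context-free condition
    (\<open>context_free_stack\<close>).

  \<^item> \<open>H\<close> is not. Put \<open>t = c p\<close> and \<open>a = (1, 0)\<close>. Moving a translation through \<open>t\<close> applies
    \<open>(i, j) \<mapsto> (i / 2 - j, i)\<close> and is possible only for even \<open>i\<close>. Each step lowers the exponent of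
    2 in the first coordinate by exactly one, so for \<open>m > 0\<close> the element \<open>t\<^sup>-\<^sup>n a\<^sup>m t\<^sup>n\<close> is a
    translation iff \<open>2\<^sup>n\<close> divides \<open>m\<close> (\<open>acts_zigzag\<close>). On the other hand, the exponent vectors
    \<open>x\<close> of the words \<open>power_word ws x\<close> in a poly-context-free language are pumpable: every infinite
    sequence of them contains \<open>x \<le> y\<close> such that all \<open>x + k (y - x)\<close> occur again
    (\<open>poly_context_free_pumpable\<close>). Along such a progression \<open>n\<close> and \<open>m\<close> grow linearly in \<open>k\<close>,
    which contradicts \<open>m \<ge> 2\<^sup>n\<close>.

  Pumpability is a consequence of Parikh's theorem that passes to finite intersections. Its proof
  rests on a description of the multisets of productions that occur in derivations, by a linear
  balance equation and a reachability condition on their supports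
  (\<open>balanced_connected_realises\<close>).
\<close>

section \<open>Multisets of productions of commutative grammars\<close>

text \<open>A rule \<open>r\<close> rewrites one occurrence of \<open>lhs r\<close> into the multiset \<open>rhs r\<close>; terminals are
  absent. \<open>realises lhs rhs M m\<close> says that \<open>M\<close> can be rewritten to nothing with \<open>m\<close> as the
  multiset of rules that are applied. The order of the applications is forgotten, which is
  what makes a characterisation of \<open>m\<close> by linear equations possible.\<close>

inductive realises :: "('r \<Rightarrow> 'v) \<Rightarrow> ('r \<Rightarrow> 'v multiset) \<Rightarrow> 'v multiset \<Rightarrow> 'r multiset \<Rightarrow> bool"
  for lhs :: "'r \<Rightarrow> 'v" and rhs :: "'r \<Rightarrow> 'v multiset" where
  realises_empty: "realises lhs rhs {#} {#}"
| realises_step: "realises lhs rhs (M + rhs r) m \<Longrightarrow>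
    realises lhs rhs (add_mset (lhs r) M) (add_mset r m)"

inductive reachable :: "('r \<Rightarrow> 'v) \<Rightarrow> ('r \<Rightarrow> 'v multiset) \<Rightarrow> 'v multiset \<Rightarrow> 'r set \<Rightarrow> 'v \<Rightarrow> bool"
  for lhs :: "'r \<Rightarrow> 'v" and rhs :: "'r \<Rightarrow> 'v multiset" and M :: "'v multiset" and R :: "'r set" where
  reachable_start: "v \<in># M \<Longrightarrow> reachable lhs rhs M R v"
| reachable_step: "reachable lhs rhs M R (lhs r) \<Longrightarrow> r \<in> R \<Longrightarrow> v \<in># rhs r \<Longrightarrow>
    reachable lhs rhs M R v"

lemma reachable_mono:
  assumes "reachable lhs rhs M R v" "R \<subseteq> R'"
  shows "reachable lhs rhs M R' v"
  using assms(1)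
proof induction
  case (reachable_start v)
  then show ?case by (rule reachable.reachable_start)
next
  case (reachable_step r v)
  then show ?case using assms(2) reachable.reachable_step[OF reachable_step.IH, of v] by blast
qed

lemma realises_balanced:
  assumes "realises lhs rhs M m"
  shows "M + (\<Sum>r\<in>#m. rhs r) = image_mset lhs m"
  using assms by induction (auto simp: ac_simps)

lemma realises_connected:
  assumes "realises lhs rhs M m" "r \<in># m"
  shows "reachable lhs rhs M (set_mset m) (lhs r)"
  using assms
proof (induction arbitrary: r)
  case (realises_step M r0 m)
  let ?reach = "reachable lhs rhs (add_mset (lhs r0) M) (set_mset (add_mset r0 m))"
  have start: "?reach (lhs r0)" by (rule reachable_start) simp
  have *: "?reach v" if "reachable lhs rhs (M + rhs r0) (set_mset m) v" for v
    using that
  proof induction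
    case (reachable_start v)
    then consider "v \<in># M" | "v \<in># rhs r0" by auto
    then show ?case
    proof cases
      case 1
      then show ?thesis by (intro reachable.reachable_start) simp
    next
      case 2
      then show ?thesis by (intro reachable_step[OF start]) simp_all
    qed
  next
    case (reachable_step r v)
    show ?case by (rule reachable.reachable_step[OF reachable_step.IH]) (use reachable_step in simp_all)
  qed
  show ?case
    using start *[OF realises_step.IH, of r] realises_step.prems by (cases "r = r0") simp_all
qed simp

text \<open>The choice of the next rule is the delicate point: a wrong one uses up the last way to
  reach other rules that still have to be applied. If \<open>B\<close> can be reached again after some
  \<open>B\<close>-rule \<open>r\<close> by means of rules for other symbols, then applying \<open>r\<close> loses nothing. If only
  one \<open>B\<close>-rule is left, it may be applied since its right-hand side is then available
  directly. In the remaining case no rule produces \<open>B\<close>, so that \<open>B\<close> occurs only once on the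
  left of the balance equation but at least twice on the right.\<close>

lemma exists_connected_step:
  assumes bal: "add_mset B M + (\<Sum>r\<in>#m. rhs r) = image_mset lhs m"
    and conn: "\<forall>r\<in>#m. reachable lhs rhs (add_mset B M) (set_mset m) (lhs r)"
  shows "\<exists>r m'. m = add_mset r m' \<and> lhs r = B \<and>
           (\<forall>r'\<in>#m'. reachable lhs rhs (M + rhs r) (set_mset m') (lhs r'))"
proof -
  let ?R0 = "{r. r \<in># m \<and> lhs r \<noteq> B}"
  let ?ret = "\<lambda>v r. r \<in># m \<and> lhs r = B \<and> reachable lhs rhs (M + rhs r) ?R0 v"
  have "B \<in># image_mset lhs m"
    unfolding bal[symmetric] by simp
  then obtain r0 where r0: "r0 \<in># m" "lhs r0 = B" by auto
  have fresh: "?ret v r" if "r \<in># m" "lhs r = B" "v \<in># M + rhs r" for v r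
    using that reachable_start[of v "M + rhs r"] by blast
  have further: "?ret v r" if "?ret (lhs s) r" "s \<in># m" "lhs s \<noteq> B" "v \<in># rhs s" for v s r
    using that reachable_step[of lhs rhs "M + rhs r" ?R0 s v] by blast
  have reach: "v = B \<or> (\<exists>r. ?ret v r)"
    if "reachable lhs rhs (add_mset B M) (set_mset m) v" for v
    using that
  proof induction
    case (reachable_start v)
    then show ?case using fresh[OF r0, of v] by auto
  next
    case (reachable_step s v)
    show ?case
    proof (cases "lhs s = B")
      case True
      then show ?thesis using reachable_step(2,3) fresh[of s v] by auto
    next
      case False
      with reachable_step.IH obtain r where "?ret (lhs s) r" by auto
      from further[OF this reachable_step(2) False reachable_step(3)] show ?thesis by blast
    qed
  qed
  obtain m0 where m0: "m = add_mset r0 m0" using r0 by (meson multi_member_split)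
  consider r where "?ret B r" | "\<And>r. \<not> ?ret B r" "B \<notin># image_mset lhs m0"
    | "\<And>r. \<not> ?ret B r" "B \<in># image_mset lhs m0" by blast
  then show ?thesis
  proof cases
    case (1 r)
    then obtain m' where m': "m = add_mset r m'" by (meson multi_member_split)
    have "?R0 \<subseteq> set_mset m'" using m' 1 by auto
    with 1 have B: "reachable lhs rhs (M + rhs r) (set_mset m') B" by (meson reachable_mono)
    have "reachable lhs rhs (M + rhs r) (set_mset m') v"
      if "reachable lhs rhs (add_mset B M) (set_mset m) v" for v
      using that
    proof induction
      case (reachable_start v)
      then show ?case using B reachable.reachable_start[of v "M + rhs r"] by auto
    next
      case (reachable_step s v)
      then have "s \<in># m' \<or> s = r" using m' by auto
      then show ?case
        using reachable.reachable_step[OF reachable_step.IH, of v]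
          reachable.reachable_start[of v "M + rhs r"] reachable_step(3) by auto
    qed
    then show ?thesis using conn m' 1 by auto
  next
    case 2
    have lhs_m0: "lhs r \<noteq> B" if "r \<in># m0" for r using 2(2) that by auto
    then have "?R0 = set_mset m0" using m0 r0 by auto
    moreover have "r = r0" if "?ret v r" for v r using that m0 lhs_m0 by auto
    ultimately have "?ret v r \<Longrightarrow> reachable lhs rhs (M + rhs r0) (set_mset m0) v" for v r
      by metis
    then have "reachable lhs rhs (M + rhs r0) (set_mset m0) (lhs r)" if "r \<in># m0" for r
      using reach[of "lhs r"] conn lhs_m0[OF that] that m0 by auto
    then show ?thesis using m0 r0 by blast
  next
    case 3
    have "B \<notin># rhs s" if s: "s \<in># m" for s
    proof (cases "lhs s = B")
      case True
      then show ?thesis using 3(1) s fresh[of s B] by auto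
    next
      case False
      with reach[of "lhs s"] conn s obtain r where "?ret (lhs s) r" by auto
      from further[OF this s False] show ?thesis using 3(1) by blast
    qed
    then have "B \<notin># (\<Sum>r\<in>#m. rhs r)" by auto
    then have "count (\<Sum>r\<in>#m. rhs r) B = 0" by (meson not_in_iff)
    moreover have "B \<notin># M" using fresh[OF r0, of B] 3(1) by auto
    ultimately have "count (add_mset B M + (\<Sum>r\<in>#m. rhs r)) B = 1"
      by (simp add: count_eq_zero_iff)
    moreover have "count (image_mset lhs m) B \<ge> 2"
      using 3(2) r0 m0 count_greater_eq_one_iff[of "image_mset lhs m0" B] by simp
    ultimately show ?thesis unfolding bal by simp
  qed
qed

text \<open>The converse of \<open>realises_balanced\<close> and \<open>realises_connected\<close>, a branching analogue of
  the existence of Eulerian paths in connected balanced graphs.\<close>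

lemma balanced_connected_realises:
  assumes "M + (\<Sum>r\<in>#m. rhs r) = image_mset lhs m"
    and "\<forall>r\<in>#m. reachable lhs rhs M (set_mset m) (lhs r)"
  shows "realises lhs rhs M m"
  using assms
proof (induction "size m" arbitrary: m M)
  case 0
  then show ?case by (auto intro: realises.intros)
next
  case (Suc n)
  have "M \<noteq> {#}"
  proof
    assume M: "M = {#}"
    have "\<not> reachable lhs rhs M (set_mset m) v" for v
    proof
      assume "reachable lhs rhs M (set_mset m) v"
      then show False by induction (use M in auto)
    qed
    moreover have "m \<noteq> {#}" using Suc(2) by auto
    ultimately show False using Suc.prems(2) by auto
  qed
  then obtain B M0 where M: "M = add_mset B M0" by (meson multiset_cases)
  obtain r m' where r: "m = add_mset r m'" "lhs r = B"
      "\<forall>r'\<in>#m'. reachable lhs rhs (M0 + rhs r) (set_mset m') (lhs r')"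
    using exists_connected_step[OF Suc.prems[unfolded M]] by blast
  have "M0 + rhs r + (\<Sum>r\<in>#m'. rhs r) = image_mset lhs m'"
    using Suc.prems(1) r M by (simp add: ac_simps)
  then have "realises lhs rhs (M0 + rhs r) m'"
    using Suc r by auto
  then show ?case using realises_step[of lhs rhs M0 r m'] r M by simp
qed

text \<open>The balance equation is linear and reachability depends only on the support, so both
  conditions pass from \<open>x \<subseteq># y\<close> with equal supports to every \<open>x + k (y - x)\<close>.\<close>

lemma realises_pump:
  assumes x: "realises lhs rhs M x" and y: "realises lhs rhs M y"
    and le: "x \<subseteq># y" and supp: "set_mset x = set_mset y"
  shows "realises lhs rhs M (x + repeat_mset k (y - x))"
proof (rule balanced_connected_realises)
  define d where "d = y - x"
  have yx: "y = x + d" using le d_def by simp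
  have "M + (\<Sum>r\<in>#x. rhs r) + (\<Sum>r\<in>#d. rhs r) = image_mset lhs x + image_mset lhs d"
    using realises_balanced[OF y] by (simp add: yx ac_simps)
  then have d: "(\<Sum>r\<in>#d. rhs r) = image_mset lhs d"
    unfolding realises_balanced[OF x] by simp
  have "M + (\<Sum>r\<in>#x + repeat_mset k d. rhs r) = image_mset lhs (x + repeat_mset k d)"
  proof (induction k)
    case 0
    then show ?case using realises_balanced[OF x] by simp
  next
    case (Suc k)
    have "M + (\<Sum>r\<in>#x + repeat_mset (Suc k) d. rhs r)
        = (M + (\<Sum>r\<in>#x + repeat_mset k d. rhs r)) + (\<Sum>r\<in>#d. rhs r)"
      by (simp add: ac_simps)
    then show ?case unfolding Suc.IH d by (simp add: ac_simps)
  qed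
  then show "M + (\<Sum>r\<in>#x + repeat_mset k (y - x). rhs r) = image_mset lhs (x + repeat_mset k (y - x))"
    by (simp add: d_def)
  have "set_mset (repeat_mset k (y - x)) \<subseteq> set_mset y"
    by (induction k) (auto dest: in_diffD)
  then have "set_mset (x + repeat_mset k (y - x)) = set_mset x"
    using supp by auto
  moreover have "\<forall>r\<in>#x. reachable lhs rhs M (set_mset x) (lhs r)"
    using realises_connected[OF x] by blast
  ultimately show "\<forall>r\<in>#x + repeat_mset k (y - x).
      reachable lhs rhs M (set_mset (x + repeat_mset k (y - x))) (lhs r)"
    by simp
qed

section \<open>Increasing subsequences of multisets\<close>

text \<open>Agreement of the zeros is recorded so that supports stay constant when this is applied
  to multiplicities.\<close>

lemma nat_seq_subseq:
  fixes a :: "nat \<Rightarrow> nat"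
  shows "\<exists>\<sigma> :: nat \<Rightarrow> nat. strict_mono \<sigma> \<and>
    (\<forall>i j. i < j \<longrightarrow> a (\<sigma> i) \<le> a (\<sigma> j) \<and> (a (\<sigma> i) = 0 \<longleftrightarrow> a (\<sigma> j) = 0))"
proof (cases "finite (range a)")
  case True
  then obtain v where "infinite {n. a n = a v}"
    using pigeonhole_infinite[of UNIV a] by auto
  from infinite_enumerate[OF this] obtain \<sigma> :: "nat \<Rightarrow> nat"
    where "strict_mono \<sigma>" "\<And>n. a (\<sigma> n) = a v"
    by auto
  then show ?thesis by (intro exI[of _ \<sigma>]) simp
next
  case False
  have ex: "\<exists>m>n. a m > a n" for n
  proof (rule ccontr)
    assume "\<not> ?thesis"
    then have "a m \<le> Max (a ` {..n})" for m
    proof (cases "m \<le> n")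
      case True
      then show ?thesis by (auto intro: Max_ge)
    next
      case False
      then have "a m \<le> a n" using \<open>\<not> (\<exists>m>n. a m > a n)\<close> by (meson linorder_not_le)
      also have "\<dots> \<le> Max (a ` {..n})" by (auto intro: Max_ge)
      finally show ?thesis .
    qed
    then have "range a \<subseteq> {..Max (a ` {..n})}" by auto
    then show False using False finite_subset by blast
  qed
  then obtain f where f: "\<And>n. f n > n \<and> a (f n) > a n" by metis
  define \<sigma> where "\<sigma> n = (f ^^ n) (f 0)" for n
  have step: "\<sigma> n < \<sigma> (Suc n)" "a (\<sigma> n) < a (\<sigma> (Suc n))" for n
    using f by (auto simp: \<sigma>_def)
  have mono: "strict_mono \<sigma>" "strict_mono (\<lambda>n. a (\<sigma> n))"
    using step by (auto simp: strict_mono_Suc_iff)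
  have pos: "a (\<sigma> n) > 0" for n
    using f[of "0"] step(2)[of "n - 1"] by (cases n) (auto simp: \<sigma>_def)
  have "a (\<sigma> i) < a (\<sigma> j)" if "i < j" for i j
    using strict_monoD[OF mono(2) that] .
  then have "a (\<sigma> i) \<le> a (\<sigma> j) \<and> (a (\<sigma> i) = 0 \<longleftrightarrow> a (\<sigma> j) = 0)" if "i < j" for i j
    using that pos[of i] pos[of j] by (simp add: less_imp_le)
  then show ?thesis using mono(1) by blast
qed

text \<open>Dickson's lemma for multisets over a finite set, refined by constant supports as
  \<open>realises_pump\<close> requires.\<close>

lemma multiset_seq_subseq:
  fixes m :: "nat \<Rightarrow> 'r multiset"
  assumes "finite R" "\<And>i. set_mset (m i) \<subseteq> R"
  shows "\<exists>\<sigma> :: nat \<Rightarrow> nat. strict_mono \<sigma> \<and>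
    (\<forall>i j. i < j \<longrightarrow> m (\<sigma> i) \<subseteq># m (\<sigma> j) \<and> set_mset (m (\<sigma> i)) = set_mset (m (\<sigma> j)))"
proof -
  have "\<exists>\<sigma> :: nat \<Rightarrow> nat. strict_mono \<sigma> \<and> (\<forall>r\<in>R. \<forall>i j. i < j \<longrightarrow> count (m (\<sigma> i)) r \<le> count (m (\<sigma> j)) r \<and>
      (count (m (\<sigma> i)) r = 0 \<longleftrightarrow> count (m (\<sigma> j)) r = 0))"
    using assms(1)
  proof induction
    case empty
    then show ?case by (intro exI[of _ id]) (auto simp: strict_mono_def)
  next
    case (insert r R)
    then obtain \<sigma> :: "nat \<Rightarrow> nat" where \<sigma>: "strict_mono \<sigma>" "\<forall>r\<in>R. \<forall>i j. i < j \<longrightarrow>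
        count (m (\<sigma> i)) r \<le> count (m (\<sigma> j)) r \<and>
        (count (m (\<sigma> i)) r = 0 \<longleftrightarrow> count (m (\<sigma> j)) r = 0)" by blast
    obtain \<tau> :: "nat \<Rightarrow> nat" where \<tau>: "strict_mono \<tau>" "\<forall>i j. i < j \<longrightarrow>
        count (m (\<sigma> (\<tau> i))) r \<le> count (m (\<sigma> (\<tau> j))) r \<and>
        (count (m (\<sigma> (\<tau> i))) r = 0 \<longleftrightarrow> count (m (\<sigma> (\<tau> j))) r = 0)"
      using nat_seq_subseq[of "\<lambda>i. count (m (\<sigma> i)) r"] by blast
    show ?case
      using \<sigma> \<tau> by (intro exI[of _ "\<sigma> \<circ> \<tau>"]) (auto simp: strict_mono_def)
  qed
  then obtain \<sigma> :: "nat \<Rightarrow> nat" where \<sigma>: "strict_mono \<sigma>" "\<forall>r\<in>R. \<forall>i j. i < j \<longrightarrow>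
        count (m (\<sigma> i)) r \<le> count (m (\<sigma> j)) r \<and>
        (count (m (\<sigma> i)) r = 0 \<longleftrightarrow> count (m (\<sigma> j)) r = 0)" by blast
  have out: "count (m i) r = 0" if "r \<notin> R" for i r
    using assms(2)[of i] that by (meson in_mono not_in_iff)
  have "count (m (\<sigma> i)) r \<le> count (m (\<sigma> j)) r \<and>
        (count (m (\<sigma> i)) r = 0 \<longleftrightarrow> count (m (\<sigma> j)) r = 0)" if "i < j" for i j r
    using \<sigma> out that by (cases "r \<in> R") auto
  then show ?thesis using \<sigma>(1)
    by (intro exI[of _ \<sigma>]) (auto simp: subseteq_mset_def count_eq_zero_iff)
qed

section \<open>Derivations along the runs of an automaton\<close>

text \<open>A symbol annotated with the states in which a run of an automaton enters and leaves it.\<close>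

type_synonym ('q, 'n, 't) asym = "'q \<times> ('n, 't) sym \<times> 'q"

abbreviation label :: "('q, 'n, 't) asym \<Rightarrow> ('n, 't) sym" where
  "label x \<equiv> fst (snd x)"

fun nts :: "('q, 'n, 't) asym list \<Rightarrow> ('q \<times> 'n \<times> 'q) multiset" where
  "nts [] = {#}"
| "nts ((a, Nt B, b) # xs) = add_mset (a, B, b) (nts xs)"
| "nts ((a, Tm t, b) # xs) = nts xs"

fun tms :: "('q, 'n, 't) asym list \<Rightarrow> ('q \<times> 't \<times> 'q) multiset" where
  "tms [] = {#}"
| "tms ((a, Nt B, b) # xs) = tms xs"
| "tms ((a, Tm t, b) # xs) = add_mset (a, t, b) (tms xs)"

lemma nts_append [simp]: "nts (xs @ ys) = nts xs + nts ys"
  by (induction xs rule: nts.induct) auto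

lemma tms_append [simp]: "tms (xs @ ys) = tms xs + tms ys"
  by (induction xs rule: tms.induct) auto

lemma nts_labels_Tm: "map label xs = map Tm w \<Longrightarrow> nts xs = {#}"
  by (induction xs arbitrary: w rule: nts.induct) auto

lemma nts_empty_labels: "nts xs = {#} \<Longrightarrow> \<exists>w. map label xs = map Tm w"
proof (induction xs rule: nts.induct)
  case (3 a t b xs)
  then obtain w where "map label xs = map Tm w" by auto
  then have "map label ((a, Tm t, b) # xs) = map Tm (t # w)" by simp
  then show ?case by blast
qed auto

lemma nts_split:
  "v \<in># nts xs \<Longrightarrow> \<exists>ys zs. xs = ys @ (fst v, Nt (fst (snd v)), snd (snd v)) # zs"
proof (induction xs rule: nts.induct)
  case (2 a B b xs)
  show ?case
  proof (cases "v = (a, B, b)")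
    case True
    then show ?thesis by (intro exI[of _ "[]"] exI[of _ xs]) simp
  next
    case False
    with 2 obtain ys zs where "xs = ys @ (fst v, Nt (fst (snd v)), snd (snd v)) # zs" by auto
    then show ?thesis by (intro exI[of _ "(a, Nt B, b) # ys"] exI[of _ zs]) simp
  qed
next
  case (3 a t b xs)
  then obtain ys zs where "xs = ys @ (fst v, Nt (fst (snd v)), snd (snd v)) # zs" by auto
  then show ?case by (intro exI[of _ "(a, Tm t, b) # ys"] exI[of _ zs]) simp
qed auto

text \<open>The preorder \<open>eps\<close> is the reachability relation by silent moves, \<open>\<Delta>\<close> is the set of
  transitions that read a terminal.\<close>

locale grammar_automaton =
  fixes P :: "('n, 't) prods" and Q :: "'q set"
    and \<Delta> :: "('q \<times> 't \<times> 'q) set" and eps :: "'q \<Rightarrow> 'q \<Rightarrow> bool"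
  assumes finite_P: "finite P" and finite_Q: "finite Q"
    and eps_refl: "eps q q"
    and eps_trans: "eps p q \<Longrightarrow> eps q r \<Longrightarrow> eps p r"
begin

text \<open>A nonterminal may connect any two states; that it derives a word which can be read
  between them is ensured by the productions in \<open>rules\<close>.\<close>

fun run :: "'q \<Rightarrow> ('q, 'n, 't) asym list \<Rightarrow> 'q \<Rightarrow> bool" where
  "run q [] q' \<longleftrightarrow> eps q q'"
| "run q ((a, X, b) # xs) q' \<longleftrightarrow>
     eps q a \<and> a \<in> Q \<and> b \<in> Q \<and> (\<forall>t. X = Tm t \<longrightarrow> (a, t, b) \<in> \<Delta>) \<and> run b xs q'"

lemma run_eps: "eps p q \<Longrightarrow> run q xs q' \<Longrightarrow> run p xs q'"
  by (cases "(q, xs, q')" rule: run.cases) (auto intro: eps_trans)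

lemma run_appendI: "run q xs p \<Longrightarrow> run p ys q' \<Longrightarrow> run q (xs @ ys) q'"
  by (induction q xs p rule: run.induct) (auto intro: run_eps)

lemma run_appendE:
  assumes "run q (xs @ ys) q'" "q \<in> Q"
  shows "\<exists>p\<in>Q. run q xs p \<and> run p ys q'"
  using assms
proof (induction xs arbitrary: q)
  case Nil
  then show ?case using eps_refl by (intro bexI[of _ q]) auto
next
  case (Cons x xs)
  then show ?case by (cases x) auto
qed

text \<open>The productions of the triple construction for the intersection of a context-free with a
  regular language. Each production keeps its annotated right-hand side, from which the
  transitions that it contributes can be read off.\<close>

definition rules :: "(('q \<times> 'n \<times> 'q) \<times> ('q, 'n, 't) asym list) set" where
  "rules = {((p, B, q), \<gamma>). p \<in> Q \<and> q \<in> Q \<and> (B, map label \<gamma>) \<in> P \<and> run p \<gamma> q}"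

lemma run_states: "run q xs q' \<Longrightarrow> (a, X, b) \<in> set xs \<Longrightarrow> a \<in> Q \<and> b \<in> Q"
  by (induction q xs q' rule: run.induct) auto

lemma finite_rules: "finite rules"
proof -
  define V where "V = (\<Union>x\<in>P. set (snd x))"
  define N where "N = Max ((\<lambda>(B, \<alpha>). length \<alpha>) ` P)"
  have "finite V" using finite_P by (auto simp: V_def)
  have "rules \<subseteq> (Q \<times> fst ` P \<times> Q) \<times> {\<gamma>. set \<gamma> \<subseteq> Q \<times> V \<times> Q \<and> length \<gamma> \<le> N}"
  proof
    fix r assume "r \<in> rules"
    then obtain p B q \<gamma> where r: "r = ((p, B, q), \<gamma>)" "p \<in> Q" "q \<in> Q"
      "(B, map label \<gamma>) \<in> P" "run p \<gamma> q" by (auto simp: rules_def)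
    have "length (map label \<gamma>) \<le> N"
      unfolding N_def using finite_P r(4) by (intro Max_ge) force+
    moreover have "set \<gamma> \<subseteq> Q \<times> V \<times> Q"
    proof
      fix x assume x: "x \<in> set \<gamma>"
      obtain a X b where abX: "x = (a, X, b)" by (cases x)
      have "X \<in> set (map label \<gamma>)" using x abX by force
      then have "X \<in> V" using r(4) by (force simp: V_def)
      then show "x \<in> Q \<times> V \<times> Q" using run_states[OF r(5)] x abX by auto
    qed
    ultimately show "r \<in> (Q \<times> fst ` P \<times> Q) \<times> {\<gamma>. set \<gamma> \<subseteq> Q \<times> V \<times> Q \<and> length \<gamma> \<le> N}"
      using r by force
  qed
  moreover have "finite ((Q \<times> fst ` P \<times> Q) \<times> {\<gamma>. set \<gamma> \<subseteq> Q \<times> V \<times> Q \<and> length \<gamma> \<le> N})"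
    using finite_P finite_Q \<open>finite V\<close> by (intro finite_cartesian_product finite_lists_length_le) auto
  ultimately show ?thesis by (rule finite_subset)
qed

abbreviation "yields \<equiv> realises (fst :: (('q \<times> 'n \<times> 'q) \<times> ('q, 'n, 't) asym list) \<Rightarrow> _) (\<lambda>r. nts (snd r))"

abbreviation "output m \<equiv> \<Sum>r\<in>#m. tms (snd (r :: ('q \<times> 'n \<times> 'q) \<times> ('q, 'n, 't) asym list))"

text \<open>A run over the derived word is pulled back through the derivation steps, starting from
  the last one: every production collapses a factor of the annotated word into one annotated
  nonterminal.\<close>

lemma derivation_yields:
  assumes "(derive1 P)\<^sup>*\<^sup>* \<alpha> (map Tm w)" "run q ts q'" "map label ts = map Tm w" "q \<in> Q"
  shows "\<exists>as m. map label as = \<alpha> \<and> run q as q' \<and> set_mset m \<subseteq> rules \<and>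
     yields (nts as) m \<and> tms as + output m = tms ts"
  using assms(1)
proof (induction rule: converse_rtranclp_induct)
  case base
  show ?case using assms nts_labels_Tm[of ts w]
    by (intro exI[of _ ts] exI[of _ "{#}"]) (auto intro: realises.intros)
next
  case (step \<alpha> \<beta>)
  then obtain as m where IH: "map label as = \<beta>" "run q as q'" "set_mset m \<subseteq> rules"
     "yields (nts as) m" "tms as + output m = tms ts" by blast
  from step(1) obtain B \<gamma> u v where B: "(B, \<gamma>) \<in> P" "\<alpha> = u @ [Nt B] @ v" "\<beta> = u @ \<gamma> @ v"
    by (auto elim: derive1.cases)
  then obtain a1 a2 a3 where a: "as = a1 @ a2 @ a3" "u = map label a1" "\<gamma> = map label a2"
      "v = map label a3"
    using IH(1) by (auto simp: map_eq_append_conv append_eq_map_conv)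
  obtain p1 p2 where p: "p1 \<in> Q" "run q a1 p1" "p2 \<in> Q" "run p1 a2 p2" "run p2 a3 q'"
    using run_appendE[of q a1 "a2 @ a3" q'] run_appendE[of _ a2 a3 q'] IH(2) assms(4)
    unfolding a by blast
  let ?as = "a1 @ [(p1, Nt B, p2)] @ a3" and ?r = "((p1, B, p2), a2)"
  have "map label ?as = \<alpha>" using B a by simp
  moreover have "run q ?as q'"
    by (intro run_appendI[OF p(2)]) (use p eps_refl in auto)
  moreover have "?r \<in> rules" using p B a by (auto simp: rules_def)
  moreover have "yields (nts ?as) (add_mset ?r m)"
    using realises_step[of fst "\<lambda>r. nts (snd r)" "nts a1 + nts a3" ?r m] IH(4)
    unfolding a by (simp add: ac_simps)
  moreover have "tms ?as + output (add_mset ?r m) = tms ts"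
    using IH(5) unfolding a by (simp add: ac_simps)
  ultimately show ?case using IH(3)
    by (intro exI[of _ ?as] exI[of _ "add_mset ?r m"]) auto
qed

text \<open>Any order of the rules is good enough: since the annotations fit together, each
  expansion of an occurrence of \<open>(p, B, q)\<close> turns a run into a run.\<close>

lemma yields_derivation:
  assumes "yields M m" "set_mset m \<subseteq> rules" "M = nts as" "run q as q'" "q \<in> Q"
  shows "\<exists>ts w. (derive1 P)\<^sup>*\<^sup>* (map label as) (map Tm w) \<and> run q ts q' \<and>
     map label ts = map Tm w \<and> tms ts = tms as + output m"
  using assms
proof (induction arbitrary: as)
  case realises_empty
  then obtain w where "map label as = map Tm w" using nts_empty_labels[of as] by auto
  then show ?case using realises_empty by (intro exI[of _ as] exI[of _ w]) auto
next
  case (realises_step M r m)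
  obtain p1 B p2 \<gamma> where r: "r = ((p1, B, p2), \<gamma>)" by (metis prod_cases3 surj_pair)
  have R: "p1 \<in> Q" "p2 \<in> Q" "(B, map label \<gamma>) \<in> P" "run p1 \<gamma> p2"
    using realises_step.prems(1) r by (auto simp: rules_def)
  have "(p1, B, p2) \<in># nts as" using realises_step.prems(2) r by (metis fst_conv union_single_eq_member)
  then obtain a1 a3 where as: "as = a1 @ (p1, Nt B, p2) # a3" using nts_split[of "(p1, B, p2)" as] by auto
  have M: "M = nts a1 + nts a3" using realises_step.prems(2) unfolding as r by simp
  obtain p where p: "run q a1 p" "eps p p1" "run p2 a3 q'"
    using run_appendE[of q a1 "(p1, Nt B, p2) # a3" q'] realises_step.prems(3,4) unfolding as by auto
  have "run q (a1 @ \<gamma> @ a3) q'"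
    by (intro run_appendI[OF p(1)] run_eps[OF p(2)] run_appendI[OF R(4)] p(3))
  moreover have "M + nts (snd r) = nts (a1 @ \<gamma> @ a3)" by (simp add: M r ac_simps)
  ultimately obtain ts w where IH: "(derive1 P)\<^sup>*\<^sup>* (map label (a1 @ \<gamma> @ a3)) (map Tm w)" "run q ts q'"
     "map label ts = map Tm w" "tms ts = tms (a1 @ \<gamma> @ a3) + output m"
    using realises_step.IH[of "a1 @ \<gamma> @ a3"] realises_step.prems by auto
  have "derive1 P (map label as) (map label (a1 @ \<gamma> @ a3))"
    using derive1.intros[OF R(3), of "map label a1" "map label a3"] by (simp add: as)
  then have "(derive1 P)\<^sup>*\<^sup>* (map label as) (map Tm w)"
    using IH(1) by (rule converse_rtranclp_into_rtranclp)
  moreover have "tms ts = tms as + output (add_mset r m)" using IH(4) by (simp add: as r ac_simps)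
  ultimately show ?case using IH by blast
qed

definition traces :: "'n \<Rightarrow> 'q \<Rightarrow> 'q \<Rightarrow> ('q \<times> 't \<times> 'q) multiset set" where
  "traces A q q' = {tms ts | ts w. run q ts q' \<and> map label ts = map Tm w \<and> w \<in> lang P A}"

lemma traces_eq_outputs:
  assumes "q \<in> Q" "q' \<in> Q"
  shows "traces A q q' = {output m | m. yields {#(q, A, q')#} m \<and> set_mset m \<subseteq> rules}"
proof (intro equalityI subsetI)
  fix T assume "T \<in> traces A q q'"
  then obtain ts w where ts: "T = tms ts" "run q ts q'" "map label ts = map Tm w"
      and der: "(derive1 P)\<^sup>*\<^sup>* [Nt A] (map Tm w)" by (auto simp: traces_def lang_def)
  from der obtain \<beta> where \<beta>: "derive1 P [Nt A] \<beta>" "(derive1 P)\<^sup>*\<^sup>* \<beta> (map Tm w)"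
    by (cases rule: converse_rtranclpE) (auto simp: Cons_eq_map_conv)
  \<comment> \<open>The first production is treated separately, so that its annotation is exactly \<open>q\<close>, \<open>q'\<close>.\<close>
  from \<beta>(1) have A: "(A, \<beta>) \<in> P"
    by (auto elim!: derive1.cases simp: Cons_eq_append_conv)
  obtain as m where as: "map label as = \<beta>" "run q as q'" "set_mset m \<subseteq> rules"
     "yields (nts as) m" "tms as + output m = tms ts"
    using derivation_yields[OF \<beta>(2) ts(2,3) assms(1)] by blast
  let ?r = "((q, A, q'), as)"
  have "?r \<in> rules" using as A assms by (auto simp: rules_def)
  moreover have "yields {#(q, A, q')#} (add_mset ?r m)"
    using realises_step[of fst "\<lambda>r. nts (snd r)" "{#}" ?r m] as by simp
  ultimately show "T \<in> {output m | m. yields {#(q, A, q')#} m \<and> set_mset m \<subseteq> rules}"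
    using as ts by (intro CollectI exI[of _ "add_mset ?r m"]) auto
next
  fix T assume "T \<in> {output m | m. yields {#(q, A, q')#} m \<and> set_mset m \<subseteq> rules}"
  then obtain m where m: "T = output m" "yields {#(q, A, q')#} m" "set_mset m \<subseteq> rules" by blast
  have "run q [(q, Nt A, q')] q'" using eps_refl assms by simp
  then obtain ts w where "(derive1 P)\<^sup>*\<^sup>* [Nt A] (map Tm w)" "run q ts q'"
      "map label ts = map Tm w" "tms ts = output m"
    using yields_derivation[OF m(2,3), of "[(q, Nt A, q')]" q q'] assms by auto
  then show "T \<in> traces A q q'"
    unfolding traces_def m(1) by (intro CollectI exI[of _ ts] exI[of _ w]) (simp add: lang_def)
qed

text \<open>Traces are linear images of realisable multisets of rules, and the latter contain a
  pumpable pair.\<close>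

lemma traces_pump:
  assumes "q \<in> Q" "q' \<in> Q" "\<And>i. T i \<in> traces A q q'"
  shows "\<exists>\<sigma> :: nat \<Rightarrow> nat. strict_mono \<sigma> \<and> (\<forall>i j. i < j \<longrightarrow> T (\<sigma> i) \<subseteq># T (\<sigma> j) \<and>
     (\<forall>k. T (\<sigma> i) + repeat_mset k (T (\<sigma> j) - T (\<sigma> i)) \<in> traces A q q'))"
proof -
  have "\<forall>i. \<exists>m. T i = output m \<and> yields {#(q, A, q')#} m \<and> set_mset m \<subseteq> rules"
    using assms(3) unfolding traces_eq_outputs[OF assms(1,2)] by blast
  then obtain m where m: "\<And>i. T i = output (m i)" "\<And>i. yields {#(q, A, q')#} (m i)"
      "\<And>i. set_mset (m i) \<subseteq> rules" by metis
  obtain \<sigma> :: "nat \<Rightarrow> nat" where \<sigma>: "strict_mono \<sigma>"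
      "\<forall>i j. i < j \<longrightarrow> m (\<sigma> i) \<subseteq># m (\<sigma> j) \<and> set_mset (m (\<sigma> i)) = set_mset (m (\<sigma> j))"
    using multiset_seq_subseq[of rules m, OF finite_rules m(3)] by (elim exE conjE) (rule that)
  have "T (\<sigma> i) \<subseteq># T (\<sigma> j) \<and> T (\<sigma> i) + repeat_mset k (T (\<sigma> j) - T (\<sigma> i)) \<in> traces A q q'"
    if "i < j" for i j k
  proof -
    define x y where "x = m (\<sigma> i)" and "y = m (\<sigma> j)"
    have xy: "x \<subseteq># y" "set_mset x = set_mset y" using \<sigma>(2) that by (auto simp: x_def y_def)
    let ?z = "x + repeat_mset k (y - x)"
    have y: "output y = output x + output (y - x)"
      by (subst subset_mset.add_diff_inverse[OF xy(1), symmetric]) (simp del: subset_mset.add_diff_inverse)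
    have "yields {#(q, A, q')#} ?z"
      using m(2) xy by (intro realises_pump) (auto simp: x_def y_def)
    moreover have "set_mset (repeat_mset k (y - x)) \<subseteq> set_mset y"
      by (induction k) (auto dest: in_diffD)
    then have "set_mset ?z \<subseteq> rules" using m(3)[of "\<sigma> i"] m(3)[of "\<sigma> j"] by (auto simp: x_def y_def)
    ultimately have "output ?z \<in> traces A q q'"
      unfolding traces_eq_outputs[OF assms(1,2)] by blast
    moreover have "output (repeat_mset k d) = repeat_mset k (output d)" for d
      by (induction k) auto
    ultimately have "output x + repeat_mset k (output (y - x)) \<in> traces A q q'" by simp
    then show ?thesis using y by (simp add: m(1) x_def y_def)
  qed
  then show ?thesis using \<sigma>(1) by blast
qed

end

section \<open>Exponent vectors in context-free languages\<close>

definition power_word :: "'t list list \<Rightarrow> (nat \<Rightarrow> nat) \<Rightarrow> 't list" where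
  "power_word ws x = concat (map (\<lambda>l. concat (replicate (x l) (ws ! l))) [0..<length ws])"

text \<open>A weakening of semilinearity that is inherited by intersections. It is phrased with a
  subsequence, rather than a single pair \<open>i < j\<close>, in order to make the induction over the
  intersected sets work. Only the coordinates below \<open>r\<close> are compared.\<close>

definition pumpable :: "nat \<Rightarrow> (nat \<Rightarrow> nat) set \<Rightarrow> bool" where
  "pumpable r E \<longleftrightarrow> (\<forall>X :: nat \<Rightarrow> nat \<Rightarrow> nat. (\<forall>i. X i \<in> E) \<longrightarrow>
     (\<exists>\<sigma> :: nat \<Rightarrow> nat. strict_mono \<sigma> \<and> (\<forall>i j. i < j \<longrightarrow> (\<forall>l<r. X (\<sigma> i) l \<le> X (\<sigma> j) l) \<and>
        (\<forall>k. (\<lambda>l. X (\<sigma> i) l + k * (X (\<sigma> j) l - X (\<sigma> i) l)) \<in> E))))"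

lemma pumpableD:
  assumes "pumpable r E" "\<And>i :: nat. X i \<in> E"
  shows "\<exists>\<sigma> :: nat \<Rightarrow> nat. strict_mono \<sigma> \<and> (\<forall>i j. i < j \<longrightarrow> (\<forall>l<r. X (\<sigma> i) l \<le> X (\<sigma> j) l) \<and>
        (\<forall>k. (\<lambda>l. X (\<sigma> i) l + k * (X (\<sigma> j) l - X (\<sigma> i) l)) \<in> E))"
  using assms unfolding pumpable_def by simp

lemma pumpable_Inter:
  assumes "finite \<E>" "\<E> \<noteq> {}" "\<forall>E\<in>\<E>. pumpable r E"
  shows "pumpable r (\<Inter>\<E>)"
  using assms
proof (induction rule: finite_ne_induct)
  case (insert E \<E>)
  show ?case
    unfolding pumpable_def
  proof (intro allI impI)
    fix X :: "nat \<Rightarrow> nat \<Rightarrow> nat" assume X: "\<forall>i. X i \<in> \<Inter>(insert E \<E>)"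
    then have "pumpable r E" "\<And>i. X i \<in> E" using insert.prems by auto
    from pumpableD[of r E X, OF this]
    obtain \<sigma> :: "nat \<Rightarrow> nat" where \<sigma>: "strict_mono \<sigma>" "\<forall>i j. i < j \<longrightarrow> (\<forall>l<r. X (\<sigma> i) l \<le> X (\<sigma> j) l) \<and>
        (\<forall>k. (\<lambda>l. X (\<sigma> i) l + k * (X (\<sigma> j) l - X (\<sigma> i) l)) \<in> E)"
      by (elim exE conjE) (rule that)
    have "pumpable r (\<Inter>\<E>)" "\<And>i. X (\<sigma> i) \<in> \<Inter>\<E>" using insert X by auto
    from pumpableD[of _ _ "\<lambda>i. X (\<sigma> i)", OF this]
    obtain \<tau> :: "nat \<Rightarrow> nat" where \<tau>: "strict_mono \<tau>"
        "\<forall>i j. i < j \<longrightarrow> (\<forall>l<r. X (\<sigma> (\<tau> i)) l \<le> X (\<sigma> (\<tau> j)) l) \<and>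
        (\<forall>k. (\<lambda>l. X (\<sigma> (\<tau> i)) l + k * (X (\<sigma> (\<tau> j)) l - X (\<sigma> (\<tau> i)) l)) \<in> \<Inter>\<E>)"
      by (elim exE conjE) (rule that)
    have "strict_mono (\<sigma> \<circ> \<tau>)" using \<sigma>(1) \<tau>(1) by (simp add: strict_mono_o)
    moreover have "(\<lambda>l. X (\<sigma> (\<tau> i)) l + k * (X (\<sigma> (\<tau> j)) l - X (\<sigma> (\<tau> i)) l)) \<in> \<Inter>(insert E \<E>)"
      if "i < j" for i j k
      using \<sigma>(2)[rule_format, of "\<tau> i" "\<tau> j"] \<tau> that by (simp add: strict_mono_less)
    ultimately show "\<exists>\<sigma> :: nat \<Rightarrow> nat. strict_mono \<sigma> \<and> (\<forall>i j. i < j \<longrightarrow> (\<forall>l<r. X (\<sigma> i) l \<le> X (\<sigma> j) l) \<and>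
        (\<forall>k. (\<lambda>l. X (\<sigma> i) l + k * (X (\<sigma> j) l - X (\<sigma> i) l)) \<in> \<Inter>(insert E \<E>)))"
      using \<tau>(2) by (intro exI[of _ "\<sigma> \<circ> \<tau>"]) auto
  qed
qed simp

text \<open>An automaton for the words that consist of copies of \<open>ws ! 0\<close>, followed by copies of
  \<open>ws ! 1\<close>, and so on. In state \<open>(l, p)\<close> the first \<open>p\<close> letters of a copy of \<open>ws ! l\<close> have been
  read; from a boundary between copies silent moves lead to the start of any block that is not
  earlier, and \<open>(r, 0)\<close> is final. Every copy of \<open>ws ! l\<close> uses exactly one transition out of
  \<open>(l, 0)\<close>, hence exponents can be recovered by counting; this is where the words have to be
  nonempty.\<close>

locale block_automaton =
  fixes ws :: "'t list list"
  assumes nonempty: "w \<in> set ws \<Longrightarrow> w \<noteq> []"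
begin

abbreviation "r \<equiv> length ws"

definition Q :: "(nat \<times> nat) set" where
  "Q = (SIGMA l:{..r}. {..if l < r then length (ws ! l) else 0})"

definition \<Delta> :: "((nat \<times> nat) \<times> 't \<times> (nat \<times> nat)) set" where
  "\<Delta> = {((l, p), ws ! l ! p, (l, Suc p)) | l p. l < r \<and> p < length (ws ! l)}"

definition eps :: "nat \<times> nat \<Rightarrow> nat \<times> nat \<Rightarrow> bool" where
  "eps a b \<longleftrightarrow> a = b \<or> (snd a = 0 \<or> (fst a < r \<and> snd a = length (ws ! fst a))) \<and>
     snd b = 0 \<and> fst a \<le> fst b"

lemma Q_iff: "(l, p) \<in> Q \<longleftrightarrow> l \<le> r \<and> p \<le> (if l < r then length (ws ! l) else 0)"
  by (simp add: Q_def)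

lemma \<Delta>_iff: "((l, p), t, b) \<in> \<Delta> \<longleftrightarrow> t = ws ! l ! p \<and> b = (l, Suc p) \<and> l < r \<and> p < length (ws ! l)"
  by (auto simp: \<Delta>_def)

lemma eps_iff: "eps (l, p) (l', p') \<longleftrightarrow>
    (l, p) = (l', p') \<or> (p = 0 \<or> (l < r \<and> p = length (ws ! l))) \<and> p' = 0 \<and> l \<le> l'"
  by (simp add: eps_def)

lemma grammar_automaton: "finite P \<Longrightarrow> grammar_automaton P Q eps"
  by unfold_locales (auto simp: Q_def eps_def)

definition block_count :: "((nat \<times> nat) \<times> 't \<times> (nat \<times> nat)) multiset \<Rightarrow> nat \<Rightarrow> nat" where
  "block_count T l = size {#x \<in># T. fst x = (l, 0)#}"

lemma block_count_simps [simp]: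
  "block_count {#} l = 0" "block_count (T + U) l = block_count T l + block_count U l"
  "block_count (add_mset x T) l = (if fst x = (l, 0) then Suc (block_count T l) else block_count T l)"
  "block_count (repeat_mset k T) l = k * block_count T l"
  by (auto simp: block_count_def; induction k; auto)+

definition tail_word :: "nat \<Rightarrow> (nat \<Rightarrow> nat) \<Rightarrow> 't list" where
  "tail_word i x = concat (map (\<lambda>l. concat (replicate (x l) (ws ! l))) [i..<r])"

lemma tail_word_step: "i < r \<Longrightarrow> tail_word i x = concat (replicate (x i) (ws ! i)) @ tail_word (Suc i) x"
  by (simp add: tail_word_def upt_conv_Cons)

lemma tail_word_cong: "(\<And>l. i \<le> l \<Longrightarrow> l < r \<Longrightarrow> x l = y l) \<Longrightarrow> tail_word i x = tail_word i y"
  unfolding tail_word_def by (intro arg_cong[where f = concat] map_cong) auto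

lemma tail_word_zero:
  "i \<le> j \<Longrightarrow> j \<le> r \<Longrightarrow> (\<And>l. i \<le> l \<Longrightarrow> l < j \<Longrightarrow> x l = 0) \<Longrightarrow> tail_word i x = tail_word j x"
  by (induction i rule: inc_induct) (auto simp: tail_word_step)

lemma tail_word_0: "tail_word 0 x = power_word ws x"
  by (simp add: tail_word_def power_word_def)

end

locale block_grammar = block_automaton ws for ws :: "'t list list" +
  fixes P :: "('n, 't) prods"
  assumes finite_prods: "finite P"
begin

sublocale grammar_automaton P Q \<Delta> eps
  using grammar_automaton[OF finite_prods] .

definition block :: "nat \<Rightarrow> nat \<Rightarrow> (nat \<times> nat, 'n, 't) asym list" where
  "block l p = map (\<lambda>p. ((l, p), Tm (ws ! l ! p), (l, Suc p))) [p..<length (ws ! l)]"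

definition blocks :: "nat \<Rightarrow> (nat \<Rightarrow> nat) \<Rightarrow> (nat \<times> nat, 'n, 't) asym list" where
  "blocks i x = concat (map (\<lambda>l. concat (replicate (x l) (block l 0))) [i..<r])"

lemma block_step:
  "p < length (ws ! l) \<Longrightarrow> block l p = ((l, p), Tm (ws ! l ! p), (l, Suc p)) # block l (Suc p)"
  by (simp add: block_def upt_conv_Cons)

lemma blocks_step: "i < r \<Longrightarrow> blocks i x = concat (replicate (x i) (block i 0)) @ blocks (Suc i) x"
  by (simp add: blocks_def upt_conv_Cons)

lemma run_block:
  assumes "l < r" "p \<le> length (ws ! l)"
  shows "run (l, p) (block l p) (l, length (ws ! l))"
  using assms(2)
proof (induction p rule: inc_induct)
  case base
  then show ?case using eps_refl by (simp add: block_def)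
next
  case (step p)
  then show ?case using eps_refl assms(1) by (auto simp: block_step Q_iff \<Delta>_iff)
qed

lemma run_replicate_block: "l < r \<Longrightarrow> run (l, 0) (concat (replicate n (block l 0))) (l, 0)"
proof (induction n)
  case 0
  then show ?case using eps_refl by simp
next
  case (Suc n)
  have "run (l, length (ws ! l)) (concat (replicate n (block l 0))) (l, 0)"
    using Suc by (intro run_eps[of "(l, length (ws ! l))" "(l, 0)"]) (auto simp: eps_iff)
  then show ?case using run_appendI[OF run_block[of l 0]] Suc.prems by simp
qed

lemma run_blocks: "i \<le> r \<Longrightarrow> run (i, 0) (blocks i x) (r, 0)"
proof (induction i rule: inc_induct)
  case base
  then show ?case using eps_refl by (simp add: blocks_def)
next
  case (step i)
  then have "run (i, 0) (blocks (Suc i) x) (r, 0)"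
    by (intro run_eps[of "(i, 0)" "(Suc i, 0)"]) (auto simp: eps_iff)
  then show ?case using run_appendI[OF run_replicate_block] step by (simp add: blocks_step)
qed

lemma label_blocks: "map label (blocks 0 x) = map Tm (power_word ws x)"
proof -
  have "map label (block l 0) = map Tm (ws ! l)" for l
    by (rule nth_equalityI) (simp_all add: block_def)
  then show ?thesis
    by (simp add: blocks_def power_word_def map_concat o_def)
qed

lemma block_count_blocks: "l < r \<Longrightarrow> block_count (tms (blocks 0 x)) l = x l"
proof -
  assume l: "l < r"
  have nz: "block_count (tms (block l' p)) l = 0" if "p > 0" "p \<le> length (ws ! l')" for l' p
    using that(2,1) by (induction p rule: inc_induct) (auto simp: block_step, simp add: block_def)
  have one: "block_count (tms (block l' 0)) l = (if l' = l then 1 else 0)" if "l' < r" for l'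
    using nonempty[OF nth_mem[OF that]] nz[of "Suc 0" l'] by (auto simp: block_step Suc_le_eq)
  have rep: "block_count (tms (concat (replicate n xs))) l = n * block_count (tms xs) l"
    for n and xs :: "(nat \<times> nat, 'n, 't) asym list"
    by (induction n) auto
  have "block_count (tms (blocks i x)) l = (if i \<le> l then x l else 0)" if "i \<le> r" for i
    using that
  proof (induction i rule: inc_induct)
    case base
    then show ?case using l by (simp add: blocks_def)
  next
    case (step i)
    then show ?case by (cases "i = l") (auto simp: blocks_step rep one)
  qed
  then show ?thesis by simp
qed

text \<open>Reading backwards from the final state, the letters read form the rest of the current
  copy followed by complete copies, in the numbers given by the transition counts.\<close>

lemma run_word:
  assumes "run (l, p) ts (r, 0)" "map label ts = map Tm w" "(l, p) \<in> Q"
  shows "w = (if p = 0 then [] else drop p (ws ! l)) @ tail_word l (block_count (tms ts)) \<and>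
     (\<forall>l'<l. block_count (tms ts) l' = 0)"
  using assms
proof (induction ts arbitrary: l p w)
  case Nil
  then have "eps (l, p) (r, 0)" and w: "w = []" by auto
  then have "l \<le> r" "p = 0 \<or> p = length (ws ! l)" by (auto simp: eps_iff)
  moreover have "tail_word l (\<lambda>_. 0) = tail_word r (\<lambda>_. 0)"
    using \<open>l \<le> r\<close> by (intro tail_word_zero) auto
  moreover have "block_count {#} = (\<lambda>_. 0)" by (rule ext) simp
  ultimately show ?case using w by (auto simp: tail_word_def)
next
  case (Cons a ts)
  obtain l1 p1 t w' where a: "a = ((l1, p1), Tm t, (l1, Suc p1))" "w = t # w'" "t = ws ! l1 ! p1"
      "l1 < r" "p1 < length (ws ! l1)" "eps (l, p) (l1, p1)" "run (l1, Suc p1) ts (r, 0)"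
      "map label ts = map Tm w'"
    using Cons.prems by (cases a; cases w) (auto simp: \<Delta>_iff)
  let ?x' = "block_count (tms ts)" and ?x = "block_count (tms (a # ts))"
  have "(l1, Suc p1) \<in> Q" using a by (auto simp: Q_iff)
  from Cons.IH[OF a(7,8) this]
  have w': "w' = drop (Suc p1) (ws ! l1) @ tail_word l1 ?x'" and z: "\<forall>l'<l1. ?x' l' = 0" by auto
  then have w: "w = drop p1 (ws ! l1) @ tail_word l1 ?x'"
    using a by (simp add: Cons_nth_drop_Suc[symmetric])
  show ?case
  proof (cases "p1 = 0")
    case False
    then have "l = l1" "p = p1" "?x = ?x'" using a by (auto simp: eps_iff fun_eq_iff)
    then show ?thesis using w z False by simp
  next
    case True
    then have lp: "l \<le> l1" "(if p = 0 then [] else drop p (ws ! l)) = []"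
      using a(6) by (auto simp: eps_iff)
    have x: "?x l' = (if l' = l1 then Suc (?x' l') else ?x' l')" for l'
      using a True by simp
    have "tail_word l ?x = tail_word l1 ?x"
      using lp a(4) z x by (intro tail_word_zero) auto
    also have "\<dots> = concat (replicate (Suc (?x' l1)) (ws ! l1)) @ tail_word (Suc l1) ?x"
      using a(4) x by (simp add: tail_word_step del: replicate_Suc)
    also have "tail_word (Suc l1) ?x = tail_word (Suc l1) ?x'"
      by (rule tail_word_cong) (use x in auto)
    finally have "tail_word l ?x = ws ! l1 @ tail_word l1 ?x'"
      using a(4) by (simp add: tail_word_step)
    moreover have "\<forall>l'<l. ?x l' = 0" using z x lp(1) by simp
    ultimately show ?thesis using w lp(2) True by simp
  qed
qed

lemma traces_blocks:
  assumes "T \<in> traces A (0, 0) (r, 0)"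
  shows "power_word ws (block_count T) \<in> lang P A"
proof -
  obtain ts w where "T = tms ts" "run (0, 0) ts (r, 0)" "map label ts = map Tm w" "w \<in> lang P A"
    using assms by (auto simp: traces_def)
  moreover have "(0, 0) \<in> Q" by (simp add: Q_iff)
  ultimately show ?thesis using run_word[of 0 0 ts w] by (simp add: tail_word_0)
qed

lemma blocks_traces:
  "power_word ws x \<in> lang P A \<Longrightarrow> tms (blocks 0 x) \<in> traces A (0, 0) (r, 0)"
  using run_blocks[of 0 x] label_blocks[of x] by (auto simp: traces_def)

lemma pumpable_slice: "pumpable r {x. power_word ws x \<in> lang P A}"
  unfolding pumpable_def
proof (intro allI impI)
  fix X :: "nat \<Rightarrow> nat \<Rightarrow> nat" assume X: "\<forall>i. X i \<in> {x. power_word ws x \<in> lang P A}"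
  define T where "T i = tms (blocks 0 (X i))" for i
  have T: "T i \<in> traces A (0, 0) (r, 0)" for i
    using X blocks_traces by (auto simp: T_def)
  have cnt: "block_count (T i) l = X i l" if "l < r" for i l
    using block_count_blocks that by (simp add: T_def)
  have "(0, 0) \<in> Q" "(r, 0) \<in> Q" by (simp_all add: Q_iff)
  from traces_pump[of _ _ T, OF this T]
  obtain \<sigma> :: "nat \<Rightarrow> nat" where \<sigma>: "strict_mono \<sigma>" "\<forall>i j. i < j \<longrightarrow> T (\<sigma> i) \<subseteq># T (\<sigma> j) \<and>
     (\<forall>k. T (\<sigma> i) + repeat_mset k (T (\<sigma> j) - T (\<sigma> i)) \<in> traces A (0, 0) (r, 0))"
    by (elim exE conjE) (rule that)
  have "(\<forall>l<r. X (\<sigma> i) l \<le> X (\<sigma> j) l) \<and>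
     power_word ws (\<lambda>l. X (\<sigma> i) l + k * (X (\<sigma> j) l - X (\<sigma> i) l)) \<in> lang P A" if ij: "i < j" for i j k
  proof -
    define D where "D = T (\<sigma> j) - T (\<sigma> i)"
    have Tj: "T (\<sigma> j) = T (\<sigma> i) + D" using \<sigma>(2) ij by (simp add: D_def)
    have D: "X (\<sigma> j) l = X (\<sigma> i) l + block_count D l" if "l < r" for l
      using cnt[OF that, of "\<sigma> j"] cnt[OF that, of "\<sigma> i"] by (simp add: Tj)
    have "power_word ws (block_count (T (\<sigma> i) + repeat_mset k D)) \<in> lang P A"
      using \<sigma>(2) ij by (intro traces_blocks) (simp add: D_def)
    also have "power_word ws (block_count (T (\<sigma> i) + repeat_mset k D)) =
       power_word ws (\<lambda>l. X (\<sigma> i) l + k * (X (\<sigma> j) l - X (\<sigma> i) l))"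
      unfolding tail_word_0[symmetric] by (rule tail_word_cong) (simp add: cnt D)
    finally show ?thesis using D by simp
  qed
  then show "\<exists>\<sigma> :: nat \<Rightarrow> nat. strict_mono \<sigma> \<and> (\<forall>i j. i < j \<longrightarrow> (\<forall>l<r. X (\<sigma> i) l \<le> X (\<sigma> j) l) \<and>
     (\<forall>k. (\<lambda>l. X (\<sigma> i) l + k * (X (\<sigma> j) l - X (\<sigma> i) l)) \<in> {x. power_word ws x \<in> lang P A}))"
    using \<sigma>(1) by blast
qed

end

lemma poly_context_free_pumpable:
  assumes "poly_context_free \<Sigma> L" "[] \<notin> set ws"
  shows "pumpable (length ws) {x. power_word ws x \<in> L}"
proof -
  obtain \<K> where K: "finite \<K>" "\<K> \<noteq> {}" "\<forall>K\<in>\<K>. context_free \<Sigma> K" "L = \<Inter>\<K>"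
    using assms(1) by (auto simp: poly_context_free_def)
  have "pumpable (length ws) {x. power_word ws x \<in> K}" if KK: "K \<in> \<K>" for K
  proof -
    obtain P :: "(nat, 'a) prods" and A where P: "finite P" and K': "K = lang P A"
      using K(3) KK unfolding context_free_def by blast
    interpret block_grammar ws P
      using assms(2) P by unfold_locales auto
    show ?thesis unfolding K' by (rule pumpable_slice)
  qed
  then have "pumpable (length ws) (\<Inter>((\<lambda>K. {x. power_word ws x \<in> K}) ` \<K>))"
    using K by (intro pumpable_Inter) auto
  moreover have "\<Inter>((\<lambda>K. {x. power_word ws x \<in> K}) ` \<K>) = {x. power_word ws x \<in> L}"
    using K by auto
  ultimately show ?thesis by simp
qed

section \<open>Lipschitz maps between Cayley graphs\<close>

lemma cayley_dist_le: "(g, h) \<in> cayley_edges G S ^^ n \<Longrightarrow> cayley_dist G S g h \<le> real n"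
  by (simp add: cayley_dist_def Least_le)

lemma cayley_dist_generator:
  "g \<in> carrier G \<Longrightarrow> s \<in> S \<Longrightarrow> g \<otimes>\<^bsub>G\<^esub> s \<in> carrier G \<Longrightarrow> cayley_dist G S g (g \<otimes>\<^bsub>G\<^esub> s) \<le> 1"
  by (rule order_trans[OF cayley_dist_le[where n = 1]]) (auto simp: cayley_edges_def)

text \<open>Any two elements are joined by a path of length \<open>cayley_dist G S x y\<close>, whose edges are
  right multiplications by generators or their inverses.\<close>

lemma lipschitz_on_generators:
  assumes G: "group G" "finite_generating_set G S" and H: "group H" "finite_generating_set H T"
    and \<phi>: "\<phi> \<in> carrier G \<rightarrow> carrier H"
    and K: "\<And>g s. g \<in> carrier G \<Longrightarrow> s \<in> S \<Longrightarrow> cayley_dist H T (\<phi> g) (\<phi> (g \<otimes>\<^bsub>G\<^esub> s)) \<le> K"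
    and x: "x \<in> carrier G" and y: "y \<in> carrier G"
  shows "cayley_dist H T (\<phi> x) (\<phi> y) \<le> K * cayley_dist G S x y"
proof -
  interpret H: Metric_space "carrier H" "cayley_dist H T"
    using Metric_space_cayley[OF H] .
  have edge: "cayley_dist H T (\<phi> g) (\<phi> h) \<le> K" if gh: "(g, h) \<in> cayley_edges G S" for g h
  proof -
    obtain s where "s \<in> S" "g \<in> carrier G" "h \<in> carrier G" "h = g \<otimes>\<^bsub>G\<^esub> s \<or> g = h \<otimes>\<^bsub>G\<^esub> s"
      using gh unfolding cayley_edges_def by blast
    then show ?thesis using K[of g s] K[of h s] H.commute[of "\<phi> g" "\<phi> h"] by fastforce
  qed
  have "y \<in> carrier G \<and> cayley_dist H T (\<phi> x) (\<phi> y) \<le> K * real n"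
    if "(x, y) \<in> cayley_edges G S ^^ n" for n y
    using that
  proof (induction n arbitrary: y)
    case 0
    have "\<phi> x \<in> carrier H" using x \<phi> by auto
    then have "cayley_dist H T (\<phi> x) (\<phi> x) = 0" using H.zero by blast
    then show ?case using 0 x by simp
  next
    case (Suc n)
    then obtain z where z: "(x, z) \<in> cayley_edges G S ^^ n" "(z, y) \<in> cayley_edges G S" by auto
    then have yz: "z \<in> carrier G" "y \<in> carrier G" by (auto simp: cayley_edges_def)
    have "cayley_dist H T (\<phi> x) (\<phi> y) \<le> cayley_dist H T (\<phi> x) (\<phi> z) + cayley_dist H T (\<phi> z) (\<phi> y)"
      using x yz \<phi> by (intro H.triangle) auto
    also have "\<dots> \<le> K * real n + K"
      using Suc.IH[OF z(1)] edge[OF z(2)] by auto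
    finally show ?case using yz by (simp add: algebra_simps)
  qed
  moreover have "\<exists>n. (x, y) \<in> cayley_edges G S ^^ n"
    using cayley_edges_connected[OF G(1), of S x y] G(2) x y by (auto simp: finite_generating_set_def)
  ultimately show ?thesis
    unfolding cayley_dist_def[of G S] using LeastI_ex[of "\<lambda>n. (x, y) \<in> cayley_edges G S ^^ n"] by blast
qed

text \<open>Two Lipschitz maps that are inverse to each other up to bounded error are
  quasi-isometries.\<close>

lemma quasi_isometric_groupsI:
  assumes G: "group G" "finite_generating_set G S" and H: "group H" "finite_generating_set H T"
    and \<phi>: "\<phi> \<in> carrier G \<rightarrow> carrier H" and \<psi>: "\<psi> \<in> carrier H \<rightarrow> carrier G"
    and K\<phi>: "\<And>g s. g \<in> carrier G \<Longrightarrow> s \<in> S \<Longrightarrow> cayley_dist H T (\<phi> g) (\<phi> (g \<otimes>\<^bsub>G\<^esub> s)) \<le> K"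
    and K\<psi>: "\<And>h t. h \<in> carrier H \<Longrightarrow> t \<in> T \<Longrightarrow> cayley_dist G S (\<psi> h) (\<psi> (h \<otimes>\<^bsub>H\<^esub> t)) \<le> K"
    and \<psi>\<phi>: "\<And>g. g \<in> carrier G \<Longrightarrow> cayley_dist G S g (\<psi> (\<phi> g)) \<le> K"
    and \<phi>\<psi>: "\<And>h. h \<in> carrier H \<Longrightarrow> cayley_dist H T (\<phi> (\<psi> h)) h \<le> K"
  shows "quasi_isometric_groups G H"
proof -
  interpret G: Metric_space "carrier G" "cayley_dist G S"
    using Metric_space_cayley[OF G] .
  interpret H: Metric_space "carrier H" "cayley_dist H T"
    using Metric_space_cayley[OF H] .
  define L where "L = max 1 K"
  have L: "L \<ge> 1" "K \<le> L" by (auto simp: L_def)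
  let ?d = "cayley_dist G S" and ?e = "cayley_dist H T"
  have up: "?e (\<phi> x) (\<phi> y) \<le> L * ?d x y" if "x \<in> carrier G" "y \<in> carrier G" for x y
    using L K\<phi> that by (intro lipschitz_on_generators[OF G H \<phi>]) (auto intro: order_trans)
  have down: "?d x y / L - 2 * L \<le> ?e (\<phi> x) (\<phi> y)" if xy: "x \<in> carrier G" "y \<in> carrier G" for x y
  proof -
    have in_carrier: "\<phi> x \<in> carrier H" "\<phi> y \<in> carrier H" "\<psi> (\<phi> x) \<in> carrier G" "\<psi> (\<phi> y) \<in> carrier G"
      using \<phi> \<psi> xy by auto
    have "?d (\<psi> (\<phi> x)) (\<psi> (\<phi> y)) \<le> L * ?e (\<phi> x) (\<phi> y)"
      using L K\<psi> in_carrier by (intro lipschitz_on_generators[OF H G \<psi>]) (auto intro: order_trans)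
    moreover have "?d x y \<le> ?d x (\<psi> (\<phi> x)) + ?d (\<psi> (\<phi> x)) y"
      "?d (\<psi> (\<phi> x)) y \<le> ?d (\<psi> (\<phi> x)) (\<psi> (\<phi> y)) + ?d (\<psi> (\<phi> y)) y"
      using xy in_carrier by (auto intro: G.triangle)
    moreover have "?d (\<psi> (\<phi> y)) y = ?d y (\<psi> (\<phi> y))" by (rule G.commute)
    ultimately have "?d x y \<le> L * ?e (\<phi> x) (\<phi> y) + 2 * L"
      using \<psi>\<phi>[OF xy(1)] \<psi>\<phi>[OF xy(2)] L by linarith
    then have "?d x y / L \<le> ?e (\<phi> x) (\<phi> y) + 2"
      using L by (simp add: field_simps)
    then show ?thesis using L by linarith
  qed
  have "quasi_isometry (carrier G) ?d (carrier H) ?e \<phi>"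
    unfolding quasi_isometry_def
  proof (rule conjI[OF \<phi>], rule exI[of _ L], rule exI[of _ "2 * L"], intro conjI ballI)
    fix z assume "z \<in> carrier H"
    then show "\<exists>x\<in>carrier G. ?e (\<phi> x) z \<le> 2 * L"
      using \<phi>\<psi>[of z] \<psi> L by (intro bexI[of _ "\<psi> z"]) auto
  next
    fix x y assume "x \<in> carrier G" "y \<in> carrier G"
    then show "?e (\<phi> x) (\<phi> y) \<le> L * ?d x y + 2 * L" using up[of x y] L by linarith
  qed (use L down in auto)
  then show ?thesis using G H unfolding quasi_isometric_groups_def by blast
qed

section \<open>Isomorphic copies\<close>

lemma cayley_dist_iso:
  assumes G: "group G" and h: "h \<in> iso G G'" and S: "S \<subseteq> carrier G"
    and x: "x \<in> carrier G" and y: "y \<in> carrier G"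
  shows "cayley_dist G' (h ` S) (h x) (h y) = cayley_dist G S x y"
proof -
  interpret group G by fact
  have bij: "bij_betw h (carrier G) (carrier G')" and hom: "h \<in> hom G G'"
    using h by (auto simp: iso_def)
  have inj: "h a = h b \<longleftrightarrow> a = b" if "a \<in> carrier G" "b \<in> carrier G" for a b
    using bij that by (auto simp: bij_betw_def inj_on_def)
  have mult: "h (a \<otimes>\<^bsub>G\<^esub> b) = h a \<otimes>\<^bsub>G'\<^esub> h b" if "a \<in> carrier G" "b \<in> carrier G" for a b
    using hom that by (auto simp: hom_def)
  have edge: "(h a, h b) \<in> cayley_edges G' (h ` S) \<longleftrightarrow> (a, b) \<in> cayley_edges G S"
    if ab: "a \<in> carrier G" "b \<in> carrier G" for a b
  proof -
    have "(h b = h a \<otimes>\<^bsub>G'\<^esub> h s \<or> h a = h b \<otimes>\<^bsub>G'\<^esub> h s) \<longleftrightarrow> 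
        (b = a \<otimes>\<^bsub>G\<^esub> s \<or> a = b \<otimes>\<^bsub>G\<^esub> s)" if "s \<in> S" for s
    proof -
      have "s \<in> carrier G" using S that by auto
      then show ?thesis using ab inj[of b "a \<otimes>\<^bsub>G\<^esub> s"] inj[of a "b \<otimes>\<^bsub>G\<^esub> s"] by (simp add: mult)
    qed
    moreover have "h a \<in> carrier G'" "h b \<in> carrier G'" using hom ab by (auto simp: hom_def)
    ultimately show ?thesis using ab by (auto simp: cayley_edges_def)
  qed
  have "(h x, h y) \<in> cayley_edges G' (h ` S) ^^ n \<longleftrightarrow> (x, y) \<in> cayley_edges G S ^^ n" for n
    using y
  proof (induction n arbitrary: y)
    case 0
    then show ?case using inj x by simp
  next
    case (Suc n)
    show ?case
    proof
      assume "(h x, h y) \<in> cayley_edges G' (h ` S) ^^ Suc n"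
      then obtain z' where z': "(h x, z') \<in> cayley_edges G' (h ` S) ^^ n" "(z', h y) \<in> cayley_edges G' (h ` S)"
        by auto
      then have "z' \<in> carrier G'" by (auto simp: cayley_edges_def)
      then obtain z where z: "z' = h z" "z \<in> carrier G" using bij by (auto simp: bij_betw_def)
      then show "(x, y) \<in> cayley_edges G S ^^ Suc n"
        using z' Suc edge[of z y] by auto
    next
      assume "(x, y) \<in> cayley_edges G S ^^ Suc n"
      then obtain z where z: "(x, z) \<in> cayley_edges G S ^^ n" "(z, y) \<in> cayley_edges G S"
        by auto
      then have "z \<in> carrier G" by (auto simp: cayley_edges_def)
      then show "(h x, h y) \<in> cayley_edges G' (h ` S) ^^ Suc n"
        using z Suc edge[of z y] by auto
    qed
  qed
  then show ?thesis by (simp add: cayley_dist_def)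
qed

lemma finite_generating_set_iso:
  assumes "group G" "group G'" "h \<in> iso G G'" "finite_generating_set G S"
  shows "finite_generating_set G' (h ` S)"
proof -
  interpret group_hom G G' h
    using assms by (auto simp: group_hom_def group_hom_axioms_def iso_def)
  have "h ` carrier G = carrier G'" using assms(3) by (auto simp: iso_def bij_betw_def)
  then show ?thesis using assms(4) generate_img[of S]
    by (auto simp: finite_generating_set_def)
qed

lemma quasi_isometric_groups_iso:
  assumes QI: "quasi_isometric_groups G H" and grp: "group G" "group G'" "group H" "group H'"
    and g: "g \<in> iso G G'" and h: "h \<in> iso H H'"
  shows "quasi_isometric_groups G' H'"
proof -
  obtain S T f where ST: "finite_generating_set G S" "finite_generating_set H T"
      and "quasi_isometry (carrier G) (cayley_dist G S) (carrier H) (cayley_dist H T) f"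
    using QI unfolding quasi_isometric_groups_def by blast
  then obtain K C where f: "f \<in> carrier G \<rightarrow> carrier H" and KC: "K \<ge> 1" "C \<ge> 0"
    "\<forall>x\<in>carrier G. \<forall>y\<in>carrier G. cayley_dist G S x y / K - C \<le> cayley_dist H T (f x) (f y) \<and>
        cayley_dist H T (f x) (f y) \<le> K * cayley_dist G S x y + C"
    "\<forall>z\<in>carrier H. \<exists>x\<in>carrier G. cayley_dist H T (f x) z \<le> C"
    unfolding quasi_isometry_def by blast
  let ?g = "inv_into (carrier G) g"
  have g': "?g x \<in> carrier G" "g (?g x) = x" if "x \<in> carrier G'" for x
    using g that by (auto simp: iso_def bij_betw_def inv_into_into f_inv_into_f)
  have gg: "?g (g x) = x" if "x \<in> carrier G" for x
    using g that by (auto simp: iso_def bij_betw_def)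
  have gc: "g x \<in> carrier G'" if "x \<in> carrier G" for x
    using g that by (auto simp: iso_def bij_betw_def)
  have dG: "cayley_dist G' (g ` S) x y = cayley_dist G S (?g x) (?g y)"
    if "x \<in> carrier G'" "y \<in> carrier G'" for x y
    using cayley_dist_iso[OF grp(1) g, of S "?g x" "?g y"] g' that ST by (simp add: finite_generating_set_def)
  have dH: "cayley_dist H' (h ` T) (h x) (h y) = cayley_dist H T x y"
    if "x \<in> carrier H" "y \<in> carrier H" for x y
    using cayley_dist_iso[OF grp(3) h] that ST by (simp add: finite_generating_set_def)
  have hc: "h ` carrier H = carrier H'" using h by (auto simp: iso_def bij_betw_def)
  have fg: "f (?g x) \<in> carrier H" if "x \<in> carrier G'" for x using f g' that by auto
  have "quasi_isometry (carrier G') (cayley_dist G' (g ` S)) (carrier H') (cayley_dist H' (h ` T))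
          (\<lambda>x. h (f (?g x)))"
    unfolding quasi_isometry_def
  proof (rule conjI, goal_cases)
    case 1
    show ?case using fg hc by auto
  next
    case 2
    show ?case
    proof (rule exI[of _ K], rule exI[of _ C], intro conjI ballI)
      fix z assume "z \<in> carrier H'"
      then obtain w where w: "z = h w" "w \<in> carrier H" using hc by auto
      then obtain x where x: "x \<in> carrier G" "cayley_dist H T (f x) w \<le> C" using KC by blast
      moreover have "f x \<in> carrier H" using f x(1) by auto
      ultimately have "cayley_dist H' (h ` T) (h (f (?g (g x)))) z \<le> C"
        using w dH[of "f x" w] gg by simp
      then show "\<exists>x\<in>carrier G'. cayley_dist H' (h ` T) (h (f (?g x))) z \<le> C"
        using gc x by blast
    qed (use KC g' fg in \<open>auto simp: dG dH\<close>)
  qed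
  then show ?thesis
    using finite_generating_set_iso[OF grp(1,2) g ST(1)] finite_generating_set_iso[OF grp(3,4) h ST(2)]
    unfolding quasi_isometric_groups_def by blast
qed

definition nat_copy :: "('a :: countable) monoid \<Rightarrow> nat monoid" where
  "nat_copy M = \<lparr>carrier = to_nat ` carrier M,
     monoid.mult = \<lambda>x y. to_nat (from_nat x \<otimes>\<^bsub>M\<^esub> from_nat y), one = to_nat \<one>\<^bsub>M\<^esub>\<rparr>"

lemma nat_copy_simps:
  "\<one>\<^bsub>nat_copy M\<^esub> = to_nat \<one>\<^bsub>M\<^esub>"
  "to_nat a \<otimes>\<^bsub>nat_copy M\<^esub> to_nat b = to_nat (a \<otimes>\<^bsub>M\<^esub> b)"
  by (simp_all add: nat_copy_def)

lemma nat_copy_iso: "to_nat \<in> iso M (nat_copy M)"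
  by (auto simp: iso_def hom_def nat_copy_def bij_betw_def intro!: inj_onI)

lemma nat_copy_group:
  assumes "group M"
  shows "group (nat_copy M)"
proof -
  interpret group M by fact
  show ?thesis
  proof (rule groupI)
    fix x assume "x \<in> carrier (nat_copy M)"
    then obtain a where "x = to_nat a" "a \<in> carrier M" by (auto simp: nat_copy_def)
    then show "\<exists>y\<in>carrier (nat_copy M). y \<otimes>\<^bsub>nat_copy M\<^esub> x = \<one>\<^bsub>nat_copy M\<^esub>"
      by (intro bexI[of _ "to_nat (inv\<^bsub>M\<^esub> a)"]) (auto simp: nat_copy_def)
  qed (auto simp: nat_copy_def m_assoc)
qed

section \<open>Words in generators\<close>

lemma (in group) word_value_Nil [simp]: "word_value G [] = \<one>"
  by (simp add: word_value_def)

lemma (in group) word_value_Cons [simp]: "word_value G (x # w) = x \<otimes> word_value G w"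
  by (simp add: word_value_def)

lemma (in group) word_value_closed [simp]: "set w \<subseteq> carrier G \<Longrightarrow> word_value G w \<in> carrier G"
  by (induction w) auto

lemma (in group) word_value_append [simp]:
  "set u \<subseteq> carrier G \<Longrightarrow> set v \<subseteq> carrier G \<Longrightarrow> word_value G (u @ v) = word_value G u \<otimes> word_value G v"
  by (induction u) (auto simp: m_assoc)

lemma (in group) word_value_power:
  "set u \<subseteq> carrier G \<Longrightarrow> word_value G (concat (replicate n u)) = word_value G u [^] n"
proof (induction n)
  case (Suc n)
  have "set (concat (replicate n u)) \<subseteq> set u" by (induction n) auto
  then show ?case
    using Suc by (subst nat_pow_Suc2) (simp_all add: subset_trans)
qed simp

lemma (in group) word_of_element:
  assumes "generate G S = carrier G" "S \<subseteq> carrier G" "symmetric_set G S" "g \<in> carrier G"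
  shows "\<exists>w. set w \<subseteq> S \<and> word_value G w = g"
proof -
  have "\<exists>w. set w \<subseteq> S \<and> word_value G w = g" if "g \<in> generate G S" for g
    using that
  proof induction
    case one
    then show ?case by (intro exI[of _ "[]"]) simp
  next
    case (incl h)
    then show ?case using assms by (intro exI[of _ "[h]"]) auto
  next
    case (inv h)
    then have "inv h \<in> S" using assms(3) by (auto simp: symmetric_set_def)
    then show ?case using assms by (intro exI[of _ "[inv h]"]) auto
  next
    case (eng h1 h2)
    then obtain u v where "set u \<subseteq> S" "word_value G u = h1" "set v \<subseteq> S" "word_value G v = h2" by blast
    then show ?case using assms(2) by (intro exI[of _ "u @ v"]) auto
  qed
  then show ?thesis using assms by simp
qed

section \<open>Reduced words and knit products\<close>

text \<open>Left multiplication of a reduced word by a letter, where \<open>\<iota>\<close> maps each letter to its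
  inverse: with \<open>\<iota> = id\<close> all letters are involutions, with \<open>\<iota> = Not\<close> on the booleans the two
  letters are a generator of \<open>\<int>\<close> and its inverse.\<close>

fun push :: "('x \<Rightarrow> 'x) \<Rightarrow> 'x \<Rightarrow> 'x list \<Rightarrow> 'x list" where
  "push \<iota> x [] = [x]"
| "push \<iota> x (y # ys) = (if y = \<iota> x then ys else x # y # ys)"

abbreviation reduced :: "('x \<Rightarrow> 'x) \<Rightarrow> 'x list \<Rightarrow> bool" where
  "reduced \<iota> \<equiv> successively (\<lambda>x y. y \<noteq> \<iota> x)"

lemma reduced_push: "reduced \<iota> f \<Longrightarrow> reduced \<iota> (push \<iota> x f)"
  by (cases f) (auto simp: successively_Cons)

lemma push_push:
  assumes "\<And>x. \<iota> (\<iota> x) = x" "reduced \<iota> f"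
  shows "push \<iota> x (push \<iota> (\<iota> x) f) = f"
proof (cases f)
  case (Cons y ys)
  then show ?thesis using assms by (cases ys) auto
qed simp

lemma push_reduced_Cons: "reduced \<iota> (x # f) \<Longrightarrow> push \<iota> x f = x # f"
  by (cases f) auto

text \<open>The multiplication of the free product of groups of order two, one for each letter.\<close>

definition cat :: "'x list \<Rightarrow> 'x list \<Rightarrow> 'x list" where
  "cat f g = foldr (push (\<lambda>x. x)) f g"

abbreviation "red \<equiv> reduced (\<lambda>x. x)"

lemma cat_simps [simp]: "cat [] g = g" "cat (x # f) g = push (\<lambda>x. x) x (cat f g)"
  by (simp_all add: cat_def)

lemma cat_append: "cat (f @ g) h = cat f (cat g h)"
  by (simp add: cat_def)

lemma red_cat: "red g \<Longrightarrow> red (cat f g)"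
  by (induction f) (auto intro: reduced_push)

lemma cat_Nil: "red f \<Longrightarrow> cat f [] = f"
proof (induction f)
  case (Cons x f)
  then have "red f" by (auto simp: successively_Cons)
  then show ?case using Cons by (simp add: push_reduced_Cons)
qed simp

lemma cat_push:
  assumes "red k" "red h"
  shows "cat (push (\<lambda>x. x) x k) h = push (\<lambda>x. x) x (cat k h)"
proof (cases k)
  case (Cons y ys)
  then show ?thesis
    using push_push[of "\<lambda>x. x" "cat ys h" y] assms red_cat[of h ys] by auto
qed simp

lemma cat_assoc: "red g \<Longrightarrow> red h \<Longrightarrow> cat (cat f g) h = cat f (cat g h)"
  by (induction f) (auto simp: cat_push red_cat)

lemma red_rev: "red f \<Longrightarrow> red (rev f)"
  by (simp add: eq_commute)

lemma cat_rev: "cat (rev f) f = []"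
  by (induction f) (auto simp: cat_append)

text \<open>The rule \<open>z x = (act z x) (res z x)\<close> for moving a group element past a letter. The first
  three laws make it compatible with addition, the last two with the relations \<open>x x = 1\<close>.\<close>

locale transducer =
  fixes act :: "'z :: ab_group_add \<Rightarrow> 'x \<Rightarrow> 'x" and res :: "'z \<Rightarrow> 'x \<Rightarrow> 'z"
  assumes act_zero: "act 0 x = x"
    and act_add: "act (z + w) x = act z (act w x)"
    and res_add: "res (z + w) x = res z (act w x) + res w x"
    and act_res: "act (res z x) x = act z x"
    and res_res: "res (res z x) x = z"
begin

lemma res_zero: "res 0 x = 0"
  using res_add[of 0 0 x] by (simp add: act_zero)

lemma act_inj: "act z x = act z y \<longleftrightarrow> x = y"
  using act_add[of "- z" z x] act_add[of "- z" z y] by (auto simp: act_zero)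

fun acts :: "'z \<Rightarrow> 'x list \<Rightarrow> 'x list" where
  "acts z [] = []"
| "acts z (x # f) = act z x # acts (res z x) f"

fun ress :: "'z \<Rightarrow> 'x list \<Rightarrow> 'z" where
  "ress z [] = z"
| "ress z (x # f) = ress (res z x) f"

lemma acts_zero [simp]: "acts 0 f = f" and ress_zero [simp]: "ress 0 f = 0"
  by (induction f) (auto simp: act_zero res_zero)

lemma acts_add: "acts (z + w) f = acts z (acts w f)"
  by (induction f arbitrary: z w) (auto simp: act_add res_add)

lemma ress_add: "ress (z + w) f = ress z (acts w f) + ress w f"
  by (induction f arbitrary: z w) (auto simp: act_add res_add)

lemma red_acts: "red f \<Longrightarrow> red (acts z f)"
proof (induction f arbitrary: z)
  case (Cons x f)
  show ?case
  proof (cases f)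
    case (Cons y g)
    have "act (res z x) y \<noteq> act z x"
      using Cons.prems Cons act_inj[of "res z x" x y] by (auto simp: act_res)
    then show ?thesis using Cons.IH[of "res z x"] Cons.prems Cons by auto
  qed simp
qed simp

lemma acts_push: "acts z (push (\<lambda>x. x) x g) = push (\<lambda>x. x) (act z x) (acts (res z x) g)"
proof (cases g)
  case (Cons y ys)
  have "act (res z x) y = act z x \<longleftrightarrow> y = x"
    using act_inj[of "res z x" y x] by (simp add: act_res)
  then show ?thesis using Cons by (auto simp: act_res res_res)
qed simp

lemma ress_push: "ress z (push (\<lambda>x. x) x g) = ress (res z x) g"
  by (cases g) (auto simp: res_res)

lemma acts_cat: "acts z (cat f g) = cat (acts z f) (acts (ress z f) g)"
  by (induction f arbitrary: z) (auto simp: acts_push)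

lemma ress_cat: "ress z (cat f g) = ress (ress z f) g"
  by (induction f arbitrary: z) (auto simp: ress_push)

text \<open>The Zappa-Szep product of the group of reduced words with the additive group.\<close>

definition knit :: "('x list \<times> 'z) monoid" where
  "knit = \<lparr>carrier = {f. red f} \<times> UNIV,
     monoid.mult = \<lambda>(f, z) (g, w). (cat f (acts z g), ress z g + w), one = ([], 0)\<rparr>"

lemma knit_carrier: "(f, z) \<in> carrier knit \<longleftrightarrow> red f"
  by (simp add: knit_def)

lemma knit_cases: "x \<in> carrier knit \<Longrightarrow> \<exists>f z. x = (f, z) \<and> red f"
  by (cases x) (auto simp: knit_carrier)

lemma knit_one: "\<one>\<^bsub>knit\<^esub> = ([], 0)"
  by (simp add: knit_def)

lemma knit_mult: "(f, z) \<otimes>\<^bsub>knit\<^esub> (g, w) = (cat f (acts z g), ress z g + w)"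
  by (simp add: knit_def)

lemma group_knit: "group knit"
proof (rule groupI)
  fix x assume "x \<in> carrier knit"
  then obtain f z where x: "x = (f, z)" "red f" by (cases x) (auto simp: knit_carrier)
  let ?y = "(acts (- z) (rev f), ress (- z) (rev f))"
  have "?y \<otimes>\<^bsub>knit\<^esub> x = (acts (- z) (cat (rev f) f), ress (- z) (cat (rev f) f) + z)"
    by (simp add: x knit_mult acts_cat ress_cat)
  then show "\<exists>y\<in>carrier knit. y \<otimes>\<^bsub>knit\<^esub> x = \<one>\<^bsub>knit\<^esub>"
    using red_acts[OF red_rev[OF x(2)]]
    by (intro bexI[of _ ?y]) (auto simp: knit_one knit_carrier cat_rev)
next
  fix x y assume "x \<in> carrier knit" "y \<in> carrier knit"
  then show "x \<otimes>\<^bsub>knit\<^esub> y \<in> carrier knit"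
    by (cases x; cases y) (auto simp: knit_carrier knit_mult intro!: red_cat red_acts)
next
  fix x y z assume "x \<in> carrier knit" "y \<in> carrier knit" "z \<in> carrier knit"
  then show "x \<otimes>\<^bsub>knit\<^esub> y \<otimes>\<^bsub>knit\<^esub> z = x \<otimes>\<^bsub>knit\<^esub> (y \<otimes>\<^bsub>knit\<^esub> z)"
    by (cases x; cases y; cases z)
      (simp add: knit_carrier knit_mult acts_cat ress_cat acts_add ress_add cat_assoc red_acts red_cat add.assoc)
qed (auto simp: knit_carrier knit_one knit_mult knit_def cat_Nil)

definition gens :: "'z set \<Rightarrow> ('x list \<times> 'z) set" where
  "gens Z = (\<lambda>x. ([x], 0)) ` UNIV \<union> (\<lambda>z. ([], z)) ` Z"

lemma gens_carrier: "gens Z \<subseteq> carrier knit"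
  by (auto simp: gens_def knit_carrier)

lemma mult_letter: "(f, z) \<otimes>\<^bsub>knit\<^esub> ([x], 0) = (cat f [act z x], res z x)"
  by (simp add: knit_mult)

lemma mult_translation: "red f \<Longrightarrow> (f, z) \<otimes>\<^bsub>knit\<^esub> ([], w) = (f, z + w)"
  by (simp add: knit_mult cat_Nil)

lemma letter_mult: "([x], 0) \<otimes>\<^bsub>knit\<^esub> (f, z) = (push (\<lambda>x. x) x f, z)"
  by (simp add: knit_mult)

lemma generate_gens:
  assumes Z: "\<And>U. 0 \<in> U \<Longrightarrow> (\<And>u z. u \<in> U \<Longrightarrow> z \<in> Z \<Longrightarrow> u + z \<in> U) \<Longrightarrow> U = (UNIV :: 'z set)"
  shows "generate knit (gens Z) = carrier knit"
proof
  interpret group knit by (rule group_knit)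
  show "generate knit (gens Z) \<subseteq> carrier knit"
    using gens_carrier by (rule generate_incl)
  have "{z. ([], z) \<in> generate knit (gens Z)} = UNIV"
  proof (rule Z)
    show "0 \<in> {z. ([], z) \<in> generate knit (gens Z)}"
      using generate.one[of knit] by (simp add: knit_one)
  next
    fix u z assume "u \<in> {z. ([], z) \<in> generate knit (gens Z)}" "z \<in> Z"
    then have "([], u) \<otimes>\<^bsub>knit\<^esub> ([], z) \<in> generate knit (gens Z)"
      by (intro generate.eng[OF _ generate.incl]) (auto simp: gens_def)
    then show "u + z \<in> {z. ([], z) \<in> generate knit (gens Z)}" by (simp add: knit_mult)
  qed
  then have translation_gen: "([], z) \<in> generate knit (gens Z)" for z by blast
  have letters: "(f, 0) \<in> generate knit (gens Z)" if "red f" for f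
    using that
  proof (induction f)
    case Nil
    show ?case by (rule translation_gen)
  next
    case (Cons x f)
    then have "red f" by (auto simp: successively_Cons)
    then have "([x], 0) \<otimes>\<^bsub>knit\<^esub> (f, 0) \<in> generate knit (gens Z)"
      using Cons.IH by (intro generate.eng[OF generate.incl]) (auto simp: gens_def)
    then show ?case using Cons.prems by (simp add: letter_mult push_reduced_Cons)
  qed
  show "carrier knit \<subseteq> generate knit (gens Z)"
  proof
    fix x assume "x \<in> carrier knit"
    then obtain f z where x: "x = (f, z)" "red f" by (cases x) (auto simp: knit_carrier)
    have "(f, 0) \<otimes>\<^bsub>knit\<^esub> ([], z) \<in> generate knit (gens Z)"
      by (intro generate.eng letters translation_gen x)
    then show "x \<in> generate knit (gens Z)" using x by (simp add: mult_translation)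
  qed
qed

end

definition units :: "(int \<times> int) set" where
  "units = {(1, 0), (-1, 0), (0, 1), (0, -1)}"

lemma units_generate:
  fixes U :: "(int \<times> int) set"
  assumes "0 \<in> U" "\<And>u z. u \<in> U \<Longrightarrow> z \<in> units \<Longrightarrow> u + z \<in> U"
  shows "U = UNIV"
proof -
  have step: "(i + a, j + b) \<in> U" if "(i, j) \<in> U" "(a, b) \<in> units" for i j a b
    using assms(2)[OF that] by simp
  have i: "(i, 0) \<in> U" for i
  proof (induction i rule: int_induct[where k = 0])
    case base
    then show ?case using assms(1) by (simp add: zero_prod_def)
  next
    case (step1 i)
    then show ?case using step[of i 0 1 0] by (simp add: units_def)
  next
    case (step2 i)
    then show ?case using step[of i 0 "-1" 0] by (simp add: units_def)
  qed
  have "(i, j) \<in> U" for i j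
  proof (induction j rule: int_induct[where k = 0])
    case base
    then show ?case by (rule i)
  next
    case (step1 j)
    then show ?case using step[of i j 0 1] by (simp add: units_def)
  next
    case (step2 j)
    then show ?case using step[of i j 0 "-1"] by (simp add: units_def)
  qed
  then show ?thesis by auto
qed

section \<open>The twisted and the untwisted product\<close>

text \<open>The involutions \<open>p\<close>, \<open>c\<close>, \<open>d\<close>.\<close>

datatype letter = Lp | Lc | Ld

instance letter :: countable by countable_datatype

lemma letter_UNIV: "UNIV = {Lp, Lc, Ld}"
  using letter.exhaust by auto

instance letter :: finite
  by standard (simp add: letter_UNIV)

fun twist_act :: "int \<times> int \<Rightarrow> letter \<Rightarrow> letter" where
  "twist_act (i, j) Lp = Lp"
| "twist_act (i, j) Lc = (if even i then Lc else Ld)"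
| "twist_act (i, j) Ld = (if even i then Ld else Lc)"

text \<open>The integer divisions come from \<open>(i, j) d = (i + 1, j) c (-1, 0)\<close> and its analogues: a
  translation with odd \<open>i\<close> is moved past \<open>c\<close> or \<open>d\<close> after splitting off a unit step, which
  rounds the halves in opposite directions.\<close>

fun twist_res :: "int \<times> int \<Rightarrow> letter \<Rightarrow> int \<times> int" where
  "twist_res (i, j) Lp = (j, i)"
| "twist_res (i, j) Lc = (i, i div 2 - j)"
| "twist_res (i, j) Ld = (i, (i + 1) div 2 - j)"

interpretation H: transducer twist_act twist_res
proof
  fix x :: letter and z w :: "int \<times> int"
  obtain i j i' j' where zw: "z = (i, j)" "w = (i', j')" by (cases z; cases w)
  show "twist_act 0 x = x" by (cases x) (simp_all add: zero_prod_def)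
  show "twist_act (z + w) x = twist_act z (twist_act w x)" by (cases x) (simp_all add: zw)
  show "twist_res (z + w) x = twist_res z (twist_act w x) + twist_res w x"
  proof -
    obtain k where i: "i = 2 * k \<or> i = 2 * k + 1" by (metis evenE oddE)
    obtain l where i': "i' = 2 * l \<or> i' = 2 * l + 1" by (metis evenE oddE)
    have "i + i' = 2 * (k + l) \<or> i + i' = 2 * (k + l) + 1 \<or> i + i' = 2 * (k + l + 1)"
      using i i' by auto
    then show ?thesis using i i' by (cases x) (auto simp: zw)
  qed
  show "twist_act (twist_res z x) x = twist_act z x" by (cases x) (simp_all add: zw)
  show "twist_res (twist_res z x) x = z" by (cases x) (simp_all add: zw)
qed


interpretation G: transducer "\<lambda>(z :: int \<times> int) (x :: letter). x" "\<lambda>z x. z"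
  by unfold_locales simp_all

lemma G_acts [simp]: "G.acts z f = f" and G_ress [simp]: "G.ress z f = z"
  by (induction f) auto

definition l1 :: "int \<times> int \<Rightarrow> int" where
  "l1 z = \<bar>fst z\<bar> + \<bar>snd z\<bar>"

lemma sum_of_units: "\<exists>zs. set zs \<subseteq> units \<and> sum_list zs = z \<and> int (length zs) = l1 z"
proof -
  obtain a b where z: "z = (a, b)" by (cases z)
  let ?zs = "replicate (nat \<bar>a\<bar>) (sgn a, 0 :: int) @ replicate (nat \<bar>b\<bar>) (0 :: int, sgn b)"
  have sum: "sum_list (replicate n (x, y)) = (int n * x, int n * y)" for n and x y :: int
    by (induction n) (auto simp: zero_prod_def algebra_simps)
  have "set ?zs \<subseteq> units" by (auto simp: units_def sgn_if split: if_splits)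
  moreover have "sum_list ?zs = z" by (simp add: sum z abs_mult_sgn)
  moreover have "int (length ?zs) = l1 z" by (simp add: z l1_def)
  ultimately show ?thesis by blast
qed

locale plane_transducer = transducer act res
  for act :: "int \<times> int \<Rightarrow> letter \<Rightarrow> letter" and res :: "int \<times> int \<Rightarrow> letter \<Rightarrow> int \<times> int"
begin

abbreviation "kdist \<equiv> cayley_dist knit (gens units)"

lemma generating: "finite_generating_set knit (gens units)"
proof -
  have "generate knit (gens units) = carrier knit"
    by (rule generate_gens, rule units_generate)
  moreover have "finite (gens units)" by (simp add: gens_def units_def)
  ultimately show ?thesis using gens_carrier by (simp add: finite_generating_set_def)
qed

sublocale Metric_space "carrier knit" kdist
  by (rule Metric_space_cayley[OF group_knit generating])

lemma translation_path:
  assumes "red f" "set zs \<subseteq> units"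
  shows "((f, w), (f, w + sum_list zs)) \<in> cayley_edges knit (gens units) ^^ length zs"
  using assms(2)
proof (induction zs arbitrary: w)
  case (Cons z zs)
  have "((f, w), (f, w + z)) \<in> cayley_edges knit (gens units)"
    using Cons.prems assms(1) mult_translation[OF assms(1), of w z]
    by (auto simp: cayley_edges_def knit_carrier gens_def intro!: bexI[of _ "([], z)"])
  moreover have "((f, w + z), (f, w + sum_list (z # zs))) \<in> cayley_edges knit (gens units) ^^ length zs"
    using Cons.IH[of "w + z"] Cons.prems by (simp add: add.assoc)
  ultimately show ?case unfolding length_Cons by (rule relpow_Suc_I2)
qed simp

lemma translation_dist:
  assumes "red f"
  shows "kdist (f, z) (f, w) \<le> l1 (w - z)"
proof -
  obtain zs where zs: "set zs \<subseteq> units" "sum_list zs = w - z" "int (length zs) = l1 (w - z)"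
    using sum_of_units by blast
  have "kdist (f, z) (f, w) \<le> real (length zs)"
    using translation_path[OF assms zs(1), of z] zs(2) by (intro cayley_dist_le) simp
  also have "\<dots> = l1 (w - z)" using zs(3) by (metis of_int_of_nat_eq)
  finally show ?thesis .
qed

lemma letter_dist:
  assumes "red f"
  shows "kdist (f, z) (cat f [act z x], w) \<le> 1 + l1 (w - res z x)"
proof -
  have r: "red (cat f [act z x])" by (rule red_cat) simp
  have "kdist (f, z) (cat f [act z x], res z x) \<le> 1"
    using cayley_dist_generator[of "(f, z)" knit "([x], 0)" "gens units"] assms r
    by (simp add: mult_letter knit_carrier gens_def)
  moreover have "kdist (cat f [act z x], res z x) (cat f [act z x], w) \<le> l1 (w - res z x)"
    by (rule translation_dist[OF r])
  moreover have "kdist (f, z) (cat f [act z x], w) \<le> kdist (f, z) (cat f [act z x], res z x) +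
      kdist (cat f [act z x], res z x) (cat f [act z x], w)"
    using assms r by (intro triangle) (auto simp: knit_carrier)
  ultimately show ?thesis by linarith
qed

end

interpretation H: plane_transducer twist_act twist_res ..
interpretation G: plane_transducer "\<lambda>z x. x" "\<lambda>z x. z" ..

section \<open>The quasi-isometry\<close>

text \<open>The action of \<open>H\<close> on the plane by isometries, given on the letters; \<open>d\<close> acts as \<open>c\<close>
  conjugated by the unit translation.\<close>

fun aff :: "letter \<Rightarrow> real \<times> real \<Rightarrow> real \<times> real" where
  "aff Lp (u, v) = (v, u)"
| "aff Lc (u, v) = (u, u / 2 - v)"
| "aff Ld (u, v) = (u, (u - 1) / 2 - v)"

text \<open>The invariant quadratic form. Working with its values instead of the norm avoids square
  roots; the triangle inequality is replaced by \<open>Q2_add\<close>.\<close>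

fun Q2 :: "real \<times> real \<Rightarrow> real" where
  "Q2 (u, v) = u\<^sup>2 - u * v / 2 + v\<^sup>2"

definition emb :: "int \<times> int \<Rightarrow> real \<times> real" where
  "emb z = (of_int (fst z), of_int (snd z))"

definition rnd :: "real \<times> real \<Rightarrow> int \<times> int" where
  "rnd u = (round (fst u), round (snd u))"

definition pos :: "letter list \<Rightarrow> real \<times> real \<Rightarrow> real \<times> real" where
  "pos f = foldr aff f"

lemma pos_simps [simp]: "pos [] u = u" "pos (x # f) u = aff x (pos f u)"
  by (simp_all add: pos_def)

lemma pos_append: "pos (f @ g) u = pos f (pos g u)"
  by (simp add: pos_def)

lemma aff_aff [simp]: "aff x (aff x u) = u"
  by (cases x; cases u) (simp_all add: field_simps)

lemma Q2_aff: "Q2 (aff x u - aff x w) = Q2 (u - w)"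
  by (cases x; cases u; cases w) (simp_all add: power2_eq_square field_simps)

lemma Q2_pos: "Q2 (pos f u - pos f w) = Q2 (u - w)"
  by (induction f) (simp_all add: Q2_aff)

lemma pos_push: "pos (push (\<lambda>x. x) x f) u = aff x (pos f u)"
  by (cases f) auto

lemma pos_cat: "pos (cat f g) u = pos f (pos g u)"
  by (induction f) (simp_all add: pos_push)

lemma pos_rev1: "pos (rev f) (pos f u) = u"
  by (induction f) (simp_all add: pos_append)

lemma pos_rev2: "pos f (pos (rev f) u) = u"
  using pos_rev1[of "rev f" u] by simp

lemma pos_rev_cat: "pos (rev (cat f [x])) u = aff x (pos (rev f) u)"
proof -
  have "pos (cat f [x]) (aff x (pos (rev f) u)) = u" by (simp add: pos_cat pos_rev2)
  then show ?thesis by (metis pos_rev1)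
qed

text \<open>The relation \<open>z x = (act z x) (res z x)\<close> of \<open>H\<close>, evaluated at the origin of the plane.
  It shows that right multiplication by a letter moves the position of an element by a bounded
  amount.\<close>

lemma aff_act: "aff (twist_act z x) (emb (twist_res z x)) = emb z + aff x 0"
proof -
  obtain i j where z: "z = (i, j)" by (cases z)
  show ?thesis
  proof (cases "even i")
    case True
    then obtain k where "i = 2 * k" by auto
    then show ?thesis using z by (cases x) (simp_all add: emb_def zero_prod_def field_simps)
  next
    case False
    then obtain k where "i = 2 * k + 1" by (auto elim: oddE)
    then show ?thesis using z by (cases x) (simp_all add: emb_def zero_prod_def field_simps)
  qed
qed

lemma Q2_lower_bound: "Q2 u \<ge> 3 / 8 * (\<bar>fst u\<bar> + \<bar>snd u\<bar>)\<^sup>2"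
proof -
  obtain a b where u: "u = (a, b)" by (cases u)
  have "0 \<le> (\<bar>a\<bar> - \<bar>b\<bar>)\<^sup>2" "a * b \<le> \<bar>a\<bar> * \<bar>b\<bar>" by (simp_all flip: abs_mult)
  then show ?thesis by (simp add: u power2_eq_square algebra_simps)
qed

lemma Q2_add: "Q2 (u + w) \<le> 2 * Q2 u + 2 * Q2 w"
proof -
  have "0 \<le> Q2 (u - w)" by (rule order_trans[OF _ Q2_lower_bound]) simp
  then show ?thesis
    by (cases u; cases w) (simp add: power2_eq_square field_simps)
qed

lemma Q2_minus: "Q2 (- u) = Q2 u"
  by (cases u) simp

lemma Q2_rnd: "Q2 (emb (rnd u) - u) \<le> 1"
proof -
  obtain a b where u: "u = (a, b)" by (cases u)
  define x y where "x = of_int (round a) - a" and "y = of_int (round b) - b"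
  have xy: "\<bar>x\<bar> \<le> 1 / 2" "\<bar>y\<bar> \<le> 1 / 2"
    using of_int_round_abs_le[of a] of_int_round_abs_le[of b] by (simp_all add: x_def y_def)
  then have "\<bar>x\<bar> * \<bar>x\<bar> \<le> 1 / 2 * (1 / 2)" "\<bar>y\<bar> * \<bar>y\<bar> \<le> 1 / 2 * (1 / 2)" "\<bar>x\<bar> * \<bar>y\<bar> \<le> 1 / 2 * (1 / 2)"
    by (intro mult_mono; simp)+
  moreover have "- (x * y) \<le> \<bar>x\<bar> * \<bar>y\<bar>" by (metis abs_ge_minus_self abs_mult)
  ultimately have "x\<^sup>2 - x * y / 2 + y\<^sup>2 \<le> 1" by (simp add: power2_eq_square)
  then show ?thesis by (simp add: u emb_def rnd_def x_def y_def)
qed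

text \<open>The constant 3 covers every displacement that occurs below; rounding both points adds at
  most a bounded amount.\<close>

lemma rnd_near:
  assumes "Q2 (u - w) \<le> 3"
  shows "l1 (rnd u - rnd w) \<le> 7"
proof -
  define d where "d = emb (rnd u) - emb (rnd w)"
  define e where "e = - (emb (rnd w) - w)"
  have "Q2 e \<le> 1" unfolding e_def Q2_minus by (rule Q2_rnd)
  then have "Q2 (u - w + e) \<le> 8" using Q2_add[of "u - w" e] assms by linarith
  then have "Q2 ((emb (rnd u) - u) + (u - w + e)) \<le> 18"
    using Q2_add[of "emb (rnd u) - u" "u - w + e"] Q2_rnd[of u] by linarith
  then have "Q2 d \<le> 18" by (simp add: d_def e_def)
  then have "(\<bar>fst d\<bar> + \<bar>snd d\<bar>)\<^sup>2 \<le> 48"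
    using Q2_lower_bound[of d] by simp
  also have "\<dots> \<le> (7 :: real)\<^sup>2" by simp
  finally have "\<bar>fst d\<bar> + \<bar>snd d\<bar> \<le> 7" by (rule power2_le_imp_le) simp
  moreover have "\<bar>fst d\<bar> + \<bar>snd d\<bar> = of_int (l1 (rnd u - rnd w))"
    by (simp add: d_def emb_def l1_def)
  ultimately show ?thesis by linarith
qed

lemma rnd_emb: "rnd (emb z) = z"
  by (simp add: rnd_def emb_def)

lemma emb_add: "emb (z + w) = emb z + emb w"
  by (simp add: emb_def)

lemma Q2_unit: "z \<in> units \<Longrightarrow> Q2 (emb z) = 1"
  by (auto simp: units_def emb_def)

lemma Q2_aff_zero: "Q2 (aff x 0) \<le> 1 / 4"
  by (cases x) (simp_all add: zero_prod_def power2_eq_square)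

lemma twist_act_twice: "twist_act z (twist_act z x) = x"
  by (cases z; cases x) auto

text \<open>The maps \<open>(f, z) \<mapsto> (f, f z)\<close> and \<open>(f, w) \<mapsto> (f, f\<^sup>-\<^sup>1 w)\<close>, rounded to the lattice, are
  Lipschitz since words act by isometries of the form \<open>Q2\<close>.\<close>

theorem quasi_isometric_knits: "quasi_isometric_groups G.knit H.knit"
proof (rule quasi_isometric_groupsI[OF G.group_knit G.generating H.group_knit H.generating, of _ _ 8])
  let ?\<phi> = "\<lambda>(f, z). (f, rnd (pos f (emb z)))" and ?\<psi> = "\<lambda>(f, z). (f, rnd (pos (rev f) (emb z)))"
  show "?\<phi> \<in> carrier H.knit \<rightarrow> carrier G.knit" "?\<psi> \<in> carrier G.knit \<rightarrow> carrier H.knit"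
    by (auto simp: H.knit_carrier G.knit_carrier)
  show "G.kdist (?\<phi> g) (?\<phi> (g \<otimes>\<^bsub>H.knit\<^esub> s)) \<le> 8"
    if c: "g \<in> carrier H.knit" and s: "s \<in> H.gens units" for g s
  proof -
    obtain f z where g: "g = (f, z)" "red f" using H.knit_cases[OF c] by blast
    consider x where "s = ([x], 0)" | w where "s = ([], w)" "w \<in> units"
      using s by (auto simp: H.gens_def)
    then show ?thesis
    proof cases
      case (1 x)
      let ?y = "twist_act z x"
      have "pos (cat f [?y]) (emb (twist_res z x)) = pos f (emb z + aff x 0)"
        by (simp add: pos_cat aff_act)
      moreover have "Q2 (pos f (emb z + aff x 0) - pos f (emb z)) \<le> 3"
        using Q2_aff_zero[of x] by (simp add: Q2_pos)
      ultimately have "l1 (rnd (pos (cat f [?y]) (emb (twist_res z x))) - rnd (pos f (emb z))) \<le> 7"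
        by (simp add: rnd_near)
      then show ?thesis
        using G.letter_dist[OF g(2), of "rnd (pos f (emb z))" ?y "rnd (pos (cat f [?y]) (emb (twist_res z x)))"]
        by (simp add: g 1 H.mult_letter)
    next
      case (2 w)
      have "Q2 (pos f (emb (z + w)) - pos f (emb z)) \<le> 3"
        using Q2_unit[OF 2(2)] by (simp add: Q2_pos emb_add)
      then have "l1 (rnd (pos f (emb (z + w))) - rnd (pos f (emb z))) \<le> 7" by (rule rnd_near)
      then show ?thesis
        using G.translation_dist[OF g(2), of "rnd (pos f (emb z))" "rnd (pos f (emb (z + w)))"]
        by (simp add: g 2 H.mult_translation)
    qed
  qed
  show "H.kdist (?\<psi> g) (?\<psi> (g \<otimes>\<^bsub>G.knit\<^esub> s)) \<le> 8"
    if c: "g \<in> carrier G.knit" and s: "s \<in> G.gens units" for g s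
  proof -
    obtain f w where g: "g = (f, w)" "red f" using G.knit_cases[OF c] by blast
    consider x where "s = ([x], 0)" | e where "s = ([], e)" "e \<in> units"
      using s by (auto simp: G.gens_def)
    then show ?thesis
    proof cases
      case (1 x)
      define u where "u = pos (rev f) (emb w)"
      define z where "z = rnd u"
      \<comment> \<open>The edge of \<open>H\<close> at \<open>(f, z)\<close> whose tree component is \<open>x\<close> is labelled by \<open>y\<close>.\<close>
      define y where "y = twist_act z x"
      have yx: "twist_act z y = x" by (simp add: y_def twist_act_twice)
      then have "emb (twist_res z y) = aff x (emb z + aff y 0)"
        using aff_act[of z y] by (metis aff_aff)
      then have "Q2 (aff x u - emb (twist_res z y)) = Q2 (u - (emb z + aff y 0))"
        by (simp add: Q2_aff)
      also have "u - (emb z + aff y 0) = - ((emb z - u) + aff y 0)" by simp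
      also have "Q2 \<dots> \<le> 3"
        using Q2_add[of "emb z - u" "aff y 0"] Q2_rnd[of u] Q2_aff_zero[of y]
        unfolding Q2_minus z_def by linarith
      finally have "l1 (rnd (aff x u) - twist_res z y) \<le> 7"
        using rnd_near[of "aff x u" "emb (twist_res z y)"] by (simp add: rnd_emb)
      then show ?thesis
        using H.letter_dist[OF g(2), of z y "rnd (aff x u)"]
        by (simp add: g 1 G.mult_letter pos_rev_cat yx flip: u_def z_def)
    next
      case (2 e)
      have "Q2 (pos (rev f) (emb (w + e)) - pos (rev f) (emb w)) \<le> 3"
        using Q2_unit[OF 2(2)] by (simp add: Q2_pos emb_add)
      then have "l1 (rnd (pos (rev f) (emb (w + e))) - rnd (pos (rev f) (emb w))) \<le> 7" by (rule rnd_near)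
      then show ?thesis
        using H.translation_dist[OF g(2), of "rnd (pos (rev f) (emb w))" "rnd (pos (rev f) (emb (w + e)))"]
        by (simp add: g 2 G.mult_translation)
    qed
  qed
  show "H.kdist (?\<psi> (?\<phi> g)) g \<le> 8" if c: "g \<in> carrier H.knit" for g
  proof -
    obtain f z where g: "g = (f, z)" "red f" using H.knit_cases[OF c] by blast
    let ?w = "rnd (pos f (emb z))"
    have "Q2 (pos (rev f) (emb ?w) - pos (rev f) (pos f (emb z))) \<le> 3"
      using Q2_rnd[of "pos f (emb z)"] by (simp add: Q2_pos)
    then have "l1 (rnd (pos (rev f) (emb ?w)) - z) \<le> 7"
      using rnd_near[of "pos (rev f) (emb ?w)" "emb z"] by (simp add: pos_rev1 rnd_emb)
    then show ?thesis
      using H.translation_dist[OF g(2), of z "rnd (pos (rev f) (emb ?w))"] H.commute[of "(f, z)"] by (simp add: g)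
  qed
  show "G.kdist h (?\<phi> (?\<psi> h)) \<le> 8" if c: "h \<in> carrier G.knit" for h
  proof -
    obtain f w where h: "h = (f, w)" "red f" using G.knit_cases[OF c] by blast
    let ?z = "rnd (pos (rev f) (emb w))"
    have "Q2 (pos f (emb ?z) - pos f (pos (rev f) (emb w))) \<le> 3"
      using Q2_rnd[of "pos (rev f) (emb w)"] by (simp add: Q2_pos)
    then have "l1 (rnd (pos f (emb ?z)) - w) \<le> 7"
      using rnd_near[of "pos f (emb ?z)" "emb w"] by (simp add: pos_rev2 rnd_emb)
    then show ?thesis
      using G.translation_dist[OF h(2), of w "rnd (pos f (emb ?z))"] by (simp add: h)
  qed
qed

section \<open>Stack languages are context-free\<close>

text \<open>A label \<open>None\<close> marks letters that the stack ignores. Nonterminals are ignored as well,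
  so that the stack content is an invariant of derivations.\<close>

definition stack_step :: "('x \<Rightarrow> 'x) \<Rightarrow> ('t \<Rightarrow> 'x option) \<Rightarrow> ('n, 't) sym \<Rightarrow> 'x list \<Rightarrow> 'x list" where
  "stack_step \<iota> lab X s = (case X of Nt _ \<Rightarrow> s | Tm t \<Rightarrow> (case lab t of None \<Rightarrow> s | Some a \<Rightarrow> push \<iota> a s))"

lemma stack_step_simps:
  "stack_step \<iota> lab (Nt A) s = s"
  "stack_step \<iota> lab (Tm t) s = (case lab t of None \<Rightarrow> s | Some a \<Rightarrow> push \<iota> a s)"
  by (simp_all add: stack_step_def)

abbreviation stack :: "('x \<Rightarrow> 'x) \<Rightarrow> ('t \<Rightarrow> 'x option) \<Rightarrow> ('n, 't) sym list \<Rightarrow> 'x list \<Rightarrow> 'x list" where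
  "stack \<iota> lab \<equiv> foldr (stack_step \<iota> lab)"

abbreviation word_stack :: "('x \<Rightarrow> 'x) \<Rightarrow> ('t \<Rightarrow> 'x option) \<Rightarrow> 't list \<Rightarrow> 'x list" where
  "word_stack \<iota> lab w \<equiv> stack \<iota> lab (map Tm w :: (nat, 't) sym list) []"

text \<open>A grammar for the words that leave every reduced stack unchanged.\<close>

definition dyck_prods :: "'t set \<Rightarrow> ('x \<Rightarrow> 'x) \<Rightarrow> ('t \<Rightarrow> 'x option) \<Rightarrow> (nat, 't) prods" where
  "dyck_prods \<Sigma> \<iota> lab = {(0, []), (0, [Nt 0, Nt 0])} \<union> {(0, [Tm y]) | y. y \<in> \<Sigma> \<and> lab y = None} \<union>
     {(0, [Tm x, Nt 0, Tm y]) | x y. x \<in> \<Sigma> \<and> y \<in> \<Sigma> \<and> (\<exists>a. lab x = Some a \<and> lab y = Some (\<iota> a))}"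

lemma finite_dyck_prods: "finite \<Sigma> \<Longrightarrow> finite (dyck_prods \<Sigma> \<iota> lab)"
proof -
  assume "finite \<Sigma>"
  show ?thesis
  proof (rule finite_subset)
    show "dyck_prods \<Sigma> \<iota> lab \<subseteq> {(0, []), (0, [Nt 0, Nt 0])} \<union>
      ((\<lambda>y. (0, [Tm y])) ` \<Sigma> \<union> (\<lambda>(x, y). (0, [Tm x, Nt 0, Tm y])) ` (\<Sigma> \<times> \<Sigma>))"
      by (auto simp: dyck_prods_def)
  qed (use \<open>finite \<Sigma>\<close> in simp)
qed

lemma reduced_stack: "reduced \<iota> s \<Longrightarrow> reduced \<iota> (stack \<iota> lab \<alpha> s)"
  by (induction \<alpha>) (auto simp: stack_step_def intro: reduced_push split: sym.split option.split)

lemma dyck_prods_stack: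
  assumes "\<And>x. \<iota> (\<iota> x) = x" "derive1 (dyck_prods \<Sigma> \<iota> lab) \<alpha> \<beta>" "reduced \<iota> s"
  shows "stack \<iota> lab \<alpha> s = stack \<iota> lab \<beta> s"
  using assms(2)
proof cases
  case (1 A \<gamma> u v)
  have "reduced \<iota> (stack \<iota> lab v s)" using assms(3) by (rule reduced_stack)
  then have "stack \<iota> lab \<gamma> (stack \<iota> lab v s) = stack \<iota> lab v s"
    using 1(3) push_push[of \<iota> "stack \<iota> lab v s", OF assms(1)]
    by (auto simp: dyck_prods_def stack_step_simps)
  then show ?thesis by (simp add: 1 stack_step_simps)
qed

lemma derive1_terminals:
  assumes "derive1 P \<alpha> \<beta>" "\<forall>(B, \<alpha>) \<in> P. \<forall>a. Tm a \<in> set \<alpha> \<longrightarrow> a \<in> \<Sigma>" "\<forall>a. Tm a \<in> set \<alpha> \<longrightarrow> a \<in> \<Sigma>"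
  shows "\<forall>a. Tm a \<in> set \<beta> \<longrightarrow> a \<in> \<Sigma>"
  using assms by cases fastforce

lemma derive_context:
  "(derive1 P)\<^sup>*\<^sup>* \<alpha> \<beta> \<Longrightarrow> (derive1 P)\<^sup>*\<^sup>* (u @ \<alpha> @ v) (u @ \<beta> @ v)"
proof (induction rule: rtranclp_induct)
  case (step \<beta> \<gamma>)
  from step(2) have "derive1 P (u @ \<beta> @ v) (u @ \<gamma> @ v)"
  proof cases
    case (1 A \<delta> u' v')
    then show ?thesis using derive1.intros[of A \<delta> P "u @ u'" "v' @ v"] by simp
  qed
  then show ?case using step by (meson rtranclp.rtrancl_into_rtrancl)
qed simp

lemma lang_productionI:
  assumes "(A, \<alpha>) \<in> P" "(derive1 P)\<^sup>*\<^sup>* \<alpha> (map Tm w)"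
  shows "w \<in> lang P A"
  using derive1.intros[OF assms(1), of "[]" "[]"] assms(2)
  by (auto simp: lang_def intro: converse_rtranclp_into_rtranclp)

context
  fixes \<Sigma> :: "'t set" and \<iota> :: "'x \<Rightarrow> 'x" and lab :: "'t \<Rightarrow> 'x option"
begin

abbreviation "dyck \<equiv> lang (dyck_prods \<Sigma> \<iota> lab) 0"

lemma dyck_Nil: "[] \<in> dyck"
  by (rule lang_productionI[of _ "[]"]) (auto simp: dyck_prods_def)

lemma dyck_neutral: "y \<in> \<Sigma> \<Longrightarrow> lab y = None \<Longrightarrow> [y] \<in> dyck"
  by (rule lang_productionI[of _ "[Tm y]"]) (auto simp: dyck_prods_def)

lemma dyck_append:
  assumes "u \<in> dyck" "v \<in> dyck"
  shows "u @ v \<in> dyck"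
proof (rule lang_productionI[of _ "[Nt 0, Nt 0]"])
  let ?d = "(derive1 (dyck_prods \<Sigma> \<iota> lab))\<^sup>*\<^sup>*"
  have "?d ([] @ [Nt 0] @ [Nt 0]) ([] @ map Tm u @ [Nt 0])"
    using assms by (intro derive_context) (simp add: lang_def)
  moreover have "?d (map Tm u @ [Nt 0] @ []) (map Tm u @ map Tm v @ [])"
    using assms by (intro derive_context) (simp add: lang_def)
  ultimately show "?d [Nt 0, Nt 0] (map Tm (u @ v))" by simp
qed (simp add: dyck_prods_def)

lemma dyck_wrap:
  assumes "u \<in> dyck" "x \<in> \<Sigma>" "y \<in> \<Sigma>" "lab x = Some a" "lab y = Some (\<iota> a)"
  shows "x # u @ [y] \<in> dyck"
proof (rule lang_productionI[of _ "[Tm x, Nt 0, Tm y]"])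
  have "(derive1 (dyck_prods \<Sigma> \<iota> lab))\<^sup>*\<^sup>* ([Tm x] @ [Nt 0] @ [Tm y]) ([Tm x] @ map Tm u @ [Tm y])"
    using assms by (intro derive_context) (simp add: lang_def)
  then show "(derive1 (dyck_prods \<Sigma> \<iota> lab))\<^sup>*\<^sup>* [Tm x, Nt 0, Tm y] (map Tm (x # u @ [y]))" by simp
qed (use assms in \<open>auto simp: dyck_prods_def\<close>)

text \<open>Locates in a word the letters that are still on the stack after it has been processed; the
  factors between them have cancelled completely.\<close>

inductive splits :: "'x list \<Rightarrow> 't list \<Rightarrow> bool" where
  splits_Nil: "d \<in> dyck \<Longrightarrow> splits [] d"
| splits_Cons: "d \<in> dyck \<Longrightarrow> y \<in> \<Sigma> \<Longrightarrow> lab y = Some a \<Longrightarrow> splits s w \<Longrightarrow> splits (a # s) (d @ y # w)"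

lemma splits_append: "d \<in> dyck \<Longrightarrow> splits s w \<Longrightarrow> splits s (d @ w)"
  by (erule splits.cases) (auto intro: splits.intros dyck_append simp flip: append_assoc)

text \<open>Words are processed from the right. A letter that cancels the top of the stack closes a
  bracket around the first separating factor, which is then absorbed into the next one.\<close>

lemma splits_word_stack:
  assumes "\<And>x. \<iota> (\<iota> x) = x" "set w \<subseteq> \<Sigma>"
  shows "splits (word_stack \<iota> lab w) w"
  using assms(2)
proof (induction w)
  case Nil
  then show ?case by (auto intro: splits_Nil dyck_Nil)
next
  case (Cons x w)
  let ?s = "word_stack \<iota> lab w"
  have IH: "splits ?s w" and x: "x \<in> \<Sigma>" using Cons by auto
  show ?case
  proof (cases "lab x")
    case None
    then show ?thesis
      using splits_append[OF dyck_neutral[OF x None] IH] by (simp add: stack_step_simps)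
  next
    case (Some a)
    have keep: "splits (a # ?s) (x # w)"
      using splits_Cons[OF dyck_Nil x Some IH] by simp
    show ?thesis
    proof (cases "\<exists>s'. ?s = \<iota> a # s'")
      case True
      then obtain s' where s': "?s = \<iota> a # s'" by blast
      with IH have "splits (\<iota> a # s') w" by simp
      then obtain d y w' where w: "w = d @ y # w'" "d \<in> dyck" "y \<in> \<Sigma>" "lab y = Some (\<iota> a)" "splits s' w'"
        by (cases rule: splits.cases) auto
      have "splits s' ((x # d @ [y]) @ w')"
        by (rule splits_append[OF dyck_wrap[OF w(2) x w(3) Some w(4)] w(5)])
      then show ?thesis using s' w Some by (simp add: stack_step_simps)
    next
      case False
      then have "push \<iota> a ?s = a # ?s" by (cases ?s) auto
      then show ?thesis using keep Some by (simp add: stack_step_simps)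
    qed
  qed
qed

lemma context_free_stack:
  assumes fin: "finite \<Sigma>" and invol: "\<And>x. \<iota> (\<iota> x) = x"
  shows "context_free \<Sigma> {w \<in> lists \<Sigma>. word_stack \<iota> lab w = []}"
proof -
  have terminals: "\<forall>(B, \<alpha>) \<in> dyck_prods \<Sigma> \<iota> lab. \<forall>a. Tm a \<in> set \<alpha> \<longrightarrow> a \<in> \<Sigma>"
    by (auto simp: dyck_prods_def)
  have "{w \<in> lists \<Sigma>. word_stack \<iota> lab w = []} = dyck"
  proof (intro equalityI subsetI)
    fix w assume "w \<in> {w \<in> lists \<Sigma>. word_stack \<iota> lab w = []}"
    then have "splits [] w" using splits_word_stack[OF invol, of w] by (auto simp: in_lists_conv_set)
    then show "w \<in> dyck" by (cases rule: splits.cases) auto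
  next
    fix w assume "w \<in> dyck"
    then have "(derive1 (dyck_prods \<Sigma> \<iota> lab))\<^sup>*\<^sup>* [Nt 0] (map Tm w)" by (simp add: lang_def)
    then have "(\<forall>a. Tm a \<in> set (map Tm w :: (nat, 't) sym list) \<longrightarrow> a \<in> \<Sigma>) \<and>
        stack \<iota> lab [Nt 0 :: (nat, 't) sym] [] = word_stack \<iota> lab w"
    proof (induction rule: rtranclp_induct)
      case (step \<beta> \<gamma>)
      then show ?case
        using derive1_terminals[OF step(2) terminals] dyck_prods_stack[OF invol step(2), of "[]"] by simp
    qed simp
    then show "w \<in> {w \<in> lists \<Sigma>. word_stack \<iota> lab w = []}"
      by (auto simp: in_lists_conv_set stack_step_simps)
  qed
  then show ?thesis
    unfolding context_free_def using finite_dyck_prods[OF fin] terminals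
    by (intro exI[of _ "dyck_prods \<Sigma> \<iota> lab"] exI[of _ 0] conjI) simp_all
qed

end

section \<open>The untwisted product is poly-context-free\<close>

definition sign_value :: "bool \<Rightarrow> int" where
  "sign_value b = (if b then 1 else - 1)"

lemma sign_value_simps [simp]: "sign_value True = 1" "sign_value False = - 1"
  by (simp_all add: sign_value_def)

lemma sum_push_Not: "(\<Sum>b\<leftarrow>push Not a s. sign_value b) = sign_value a + (\<Sum>b\<leftarrow>s. sign_value b)"
  by (cases s; cases a) auto

text \<open>Without cancellation the stack contains one sign only, hence its height is the absolute
  value of the sum.\<close>

lemma reduced_Not_replicate: "reduced Not (b # s) \<Longrightarrow> s = replicate (length s) b"
  by (induction s arbitrary: b) auto

lemma reduced_Not_sum: "reduced Not s \<Longrightarrow> (\<Sum>b\<leftarrow>s. sign_value b) = 0 \<longleftrightarrow> s = []"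
proof (cases s)
  case (Cons b s')
  assume "reduced Not s"
  then have "s = replicate (Suc (length s')) b" using reduced_Not_replicate[of b s'] Cons by simp
  then have "(\<Sum>b\<leftarrow>s. sign_value b) = int (Suc (length s')) * sign_value b"
    by (metis sum_list_replicate map_replicate of_nat_id mult.commute)
  then show ?thesis using Cons by (auto simp: sign_value_def)
qed simp

definition sign_label :: "int \<Rightarrow> bool option" where
  "sign_label a = (if a = 1 then Some True else if a = - 1 then Some False else None)"

lemma sign_label_simps [simp]:
  "sign_label 1 = Some True" "sign_label (- 1) = Some False" "sign_label 0 = None"
  by (simp_all add: sign_label_def)

lemma word_stack_sum:
  assumes "\<And>t. t \<in> set w \<Longrightarrow> c t \<in> {-1, 0, 1}"
  shows "word_stack Not (\<lambda>t. sign_label (c t)) w = [] \<longleftrightarrow> (\<Sum>t\<leftarrow>w. c t) = 0"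
proof -
  have "(\<Sum>b\<leftarrow>word_stack Not (\<lambda>t. sign_label (c t)) w. sign_value b) = (\<Sum>t\<leftarrow>w. c t)"
    using assms
  proof (induction w)
    case (Cons t w)
    have IH: "(\<Sum>b\<leftarrow>word_stack Not (\<lambda>t. sign_label (c t)) w. sign_value b) = (\<Sum>t\<leftarrow>w. c t)"
      using Cons by simp
    consider "c t = 1" | "c t = - 1" | "c t = 0" using Cons.prems[of t] by auto
    then show ?case using IH by cases (simp_all add: stack_step_simps sum_push_Not)
  qed simp
  moreover have "reduced Not (word_stack Not (\<lambda>t. sign_label (c t)) w)"
    by (rule reduced_stack) simp
  ultimately show ?thesis using reduced_Not_sum by metis
qed

lemma symmetric_set_iso:
  assumes "group G" "group G'" "h \<in> iso G G'" "S \<subseteq> carrier G" "symmetric_set G S"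
  shows "symmetric_set G' (h ` S)"
proof -
  interpret group_hom G G' h
    using assms by (auto simp: group_hom_def group_hom_axioms_def iso_def)
  have "(\<lambda>s. inv\<^bsub>G'\<^esub> s) ` h ` S = h ` (\<lambda>s. inv\<^bsub>G\<^esub> s) ` S"
    using assms(4) by (auto simp: image_iff subset_iff)
  then show ?thesis using assms(5) by (simp add: symmetric_set_def)
qed

lemma (in transducer) symmetric_gens:
  assumes "uminus ` Z = Z"
  shows "symmetric_set knit (gens Z)"
proof -
  interpret group knit by (rule group_knit)
  have letter: "inv\<^bsub>knit\<^esub> ([x], 0) = ([x], 0)" for x
    by (rule inv_equality) (auto simp: knit_mult knit_one knit_carrier act_zero res_zero)
  have translation_gen: "inv\<^bsub>knit\<^esub> ([], z) = ([], - z)" for z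
    by (rule inv_equality) (auto simp: knit_mult knit_one knit_carrier)
  have "(\<lambda>s. inv\<^bsub>knit\<^esub> s) ` gens Z = (\<lambda>x. ([x], 0)) ` UNIV \<union> (\<lambda>z. ([], z)) ` uminus ` Z"
    by (simp add: gens_def image_Un image_image letter translation_gen)
  then show ?thesis using assms by (simp add: symmetric_set_def gens_def)
qed

lemma uminus_units: "uminus ` units = units"
  by (auto simp: units_def)

definition letter_label :: "letter list \<Rightarrow> letter option" where
  "letter_label f = (case f of [] \<Rightarrow> None | x # _ \<Rightarrow> Some x)"

lemma poly_context_free_G: "poly_context_free_group (nat_copy G.knit)"
proof -
  interpret N: group "nat_copy G.knit" by (rule nat_copy_group[OF G.group_knit])
  let ?S = "to_nat ` G.gens units"
  let ?f = "\<lambda>t. fst (from_nat t :: letter list \<times> int \<times> int)"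
  let ?a = "\<lambda>t. fst (snd (from_nat t :: letter list \<times> int \<times> int))"
  let ?b = "\<lambda>t. snd (snd (from_nat t :: letter list \<times> int \<times> int))"
  let ?L1 = "{w \<in> lists ?S. word_stack (\<lambda>x. x) (\<lambda>t. letter_label (?f t)) w = []}"
  let ?L2 = "{w \<in> lists ?S. word_stack Not (\<lambda>t. sign_label (?a t)) w = []}"
  let ?L3 = "{w \<in> lists ?S. word_stack Not (\<lambda>t. sign_label (?b t)) w = []}"
  have gen: "finite_generating_set (nat_copy G.knit) ?S"
    by (rule finite_generating_set_iso[OF G.group_knit N.group_axioms nat_copy_iso G.generating])
  then have fin: "finite ?S" by (simp add: finite_generating_set_def)
  have sym: "symmetric_set (nat_copy G.knit) ?S"
    by (rule symmetric_set_iso[OF G.group_knit N.group_axioms nat_copy_iso G.gens_carrier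
          G.symmetric_gens[OF uminus_units]])
  have val: "word_value (nat_copy G.knit) w =
      to_nat (word_stack (\<lambda>x. x) (\<lambda>t. letter_label (?f t)) w, (\<Sum>t\<leftarrow>w. ?a t), (\<Sum>t\<leftarrow>w. ?b t))"
    if "w \<in> lists ?S" for w
    using that
  proof (induction w)
    case Nil
    then show ?case by (simp add: nat_copy_simps G.knit_one zero_prod_def)
  next
    case (Cons t w)
    then have IH: "word_value (nat_copy G.knit) w =
      to_nat (word_stack (\<lambda>x. x) (\<lambda>t. letter_label (?f t)) w, (\<Sum>t\<leftarrow>w. ?a t), (\<Sum>t\<leftarrow>w. ?b t))"
      and t: "t \<in> ?S" by auto
    from t consider x where "t = to_nat ([x] :: letter list, 0 :: int \<times> int)"
      | z where "t = to_nat ([] :: letter list, z :: int \<times> int)" by (auto simp: G.gens_def)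
    then show ?case
      by cases (auto simp: IH nat_copy_simps G.knit_mult stack_step_simps letter_label_def zero_prod_def)
  qed
  have coords: "?a t \<in> {-1, 0, 1}" "?b t \<in> {-1, 0, 1}" if "t \<in> ?S" for t
    using that by (auto simp: G.gens_def units_def zero_prod_def)
  have "word_problem (nat_copy G.knit) ?S = \<Inter>{?L1, ?L2, ?L3}"
  proof -
    have "word_value (nat_copy G.knit) w = \<one>\<^bsub>nat_copy G.knit\<^esub> \<longleftrightarrow> w \<in> ?L1 \<and> w \<in> ?L2 \<and> w \<in> ?L3"
      if w: "w \<in> lists ?S" for w
      using w coords word_stack_sum[of w ?a] word_stack_sum[of w ?b]
      by (auto simp: val[OF w] nat_copy_simps G.knit_one zero_prod_def in_lists_conv_set)
    then show ?thesis by (auto simp: word_problem_def)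
  qed
  moreover have "context_free ?S ?L1" "context_free ?S ?L2" "context_free ?S ?L3"
    using fin by (intro context_free_stack; simp)+
  ultimately have "poly_context_free ?S (word_problem (nat_copy G.knit) ?S)"
    unfolding poly_context_free_def by (intro exI[of _ "{?L1, ?L2, ?L3}"]) auto
  then show ?thesis using gen sym unfolding poly_context_free_group_def by blast
qed

section \<open>The twisted product is not poly-context-free\<close>

text \<open>The subgroup \<open>N\<close> plays the role of the translations. Membership of \<open>t\<^sup>-\<^sup>n a\<^sup>m t\<^sup>n\<close> in
  \<open>N\<close> means that this word, followed by suitable powers of \<open>a\<close>, \<open>a\<^sup>-\<^sup>1\<close>, \<open>b\<close> and \<open>b\<^sup>-\<^sup>1\<close>,
  represents the identity; the exponent vectors of such words would be pumpable. Taking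
  \<open>m = 2\<^sup>n\<close> for every \<open>n\<close> and pumping twice leads to a vector with \<open>m < 2\<^sup>n\<close>.\<close>

lemma (in group) not_poly_context_free_groupI:
  assumes t: "t \<in> carrier G" and a: "a \<in> carrier G" and b: "b \<in> carrier G" and N: "subgroup N G"
    and coords: "\<And>z. z \<in> N \<Longrightarrow> \<exists>p p' q q'. z \<otimes> (a [^] (p :: nat) \<otimes> (inv a [^] (p' :: nat) \<otimes>
        (b [^] (q :: nat) \<otimes> inv b [^] (q' :: nat)))) = \<one>"
    and ab: "a \<in> N" "b \<in> N"
    and enters: "\<And>n :: nat. \<exists>z\<in>N. a [^] ((2 :: nat) ^ n) \<otimes> t [^] n = t [^] n \<otimes> z"
    and sparse: "\<And>n m z. z \<in> N \<Longrightarrow> 0 < m \<Longrightarrow>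
      a [^] (m :: nat) \<otimes> t [^] (n :: nat) = t [^] n \<otimes> z \<Longrightarrow> 2 ^ n \<le> m"
  shows "\<not> poly_context_free_group G"
proof
  assume "poly_context_free_group G"
  then obtain S where S: "finite_generating_set G S" "symmetric_set G S" "poly_context_free S (word_problem G S)"
    by (auto simp: poly_context_free_group_def)
  have SG: "S \<subseteq> carrier G" "generate G S = carrier G" using S(1) by (auto simp: finite_generating_set_def)
  note word = word_of_element[OF SG(2,1) S(2)]
  have NG: "z \<in> carrier G" if "z \<in> N" for z using subgroup.mem_carrier[OF N that] .
  have "t \<noteq> \<one>"
  proof
    assume "t = \<one>"
    then have "2 ^ 1 \<le> (1 :: nat)" using a ab by (intro sparse[of a 1 1]) auto
    then show False by simp
  qed
  obtain u u' where u: "set u \<subseteq> S" "word_value G u = t" and u': "set u' \<subseteq> S" "word_value G u' = inv t"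
    using word[OF t] word[of "inv t"] t by auto
  have ne: "u \<noteq> []" using u \<open>t \<noteq> \<one>\<close> by auto
  \<comment> \<open>A word for a nontrivial element and its inverse is put in front, as
    \<open>a\<close> or \<open>b\<close> might have only the empty word.\<close>
  have nonempty_word: "\<exists>w. set w \<subseteq> S \<and> word_value G w = g \<and> w \<noteq> []" if g: "g \<in> carrier G" for g
  proof -
    obtain w where w: "set w \<subseteq> S" "word_value G w = g" using word[OF g] by blast
    have "set u \<subseteq> carrier G" "set u' \<subseteq> carrier G" "set w \<subseteq> carrier G" using u u' w SG by auto
    then have "word_value G (u @ u' @ w) = g" using u u' w t g by (simp add: m_assoc[symmetric])
    then show ?thesis using u u' w ne by (intro exI[of _ "u @ u' @ w"]) auto
  qed
  then obtain W where W: "\<And>g. g \<in> carrier G \<Longrightarrow> set (W g) \<subseteq> S \<and> word_value G (W g) = g \<and> W g \<noteq> []"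
    by metis
  define ws where "ws = map W [inv t, a, t, a, inv a, b, inv b]"
  have len: "length ws = 7" by (simp add: ws_def)
  have in_G: "set (W g) \<subseteq> carrier G" if "g \<in> carrier G" for g using W[OF that] SG by auto
  have pw: "set (concat (replicate n (W g))) \<subseteq> set (W g)" for n g by (induction n) auto
  have pw_G: "set (concat (replicate n (W g))) \<subseteq> carrier G" if "g \<in> carrier G" for n g
    using pw in_G[OF that] by (rule subset_trans)
  have pw_S: "set (concat (replicate n (W g))) \<subseteq> S" if "g \<in> carrier G" for n g
    using pw W[OF that] by (meson subset_trans)
  have pw_val: "word_value G (concat (replicate n (W g))) = g [^] n" if "g \<in> carrier G" for n g
    using word_value_power[OF in_G[OF that]] W[OF that] by simp
  have upt7: "[0..<7] = [0, 1, 2, 3, 4, 5, 6 :: nat]" by (simp add: upt_rec)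
  have power_word: "power_word ws x = concat (replicate (x 0) (W (inv t))) @ concat (replicate (x 1) (W a)) @
      concat (replicate (x 2) (W t)) @ concat (replicate (x 3) (W a)) @ concat (replicate (x 4) (W (inv a))) @
      concat (replicate (x 5) (W b)) @ concat (replicate (x 6) (W (inv b)))" for x
    unfolding power_word_def len upt7 by (simp add: ws_def)
  define E where "E = {x. power_word ws x \<in> word_problem G S}"
  define tail where "tail x = a [^] (x 3 :: nat) \<otimes> (inv a [^] (x 4 :: nat) \<otimes>
      (b [^] (x 5 :: nat) \<otimes> inv b [^] (x 6 :: nat)))"
    for x :: "nat \<Rightarrow> nat"
  have tail_N: "tail x \<in> N" for x
  proof -
    have "g [^] n \<in> N" if "g \<in> N" for g and n :: nat
      by (induction n) (use that N in \<open>auto intro: subgroup.one_closed subgroup.m_closed\<close>)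
    then show ?thesis using ab N by (simp add: tail_def subgroup.m_closed subgroup.m_inv_closed)
  qed
  have E: "x \<in> E \<longleftrightarrow> inv t [^] x 0 \<otimes> (a [^] x 1 \<otimes> (t [^] x 2 \<otimes> tail x)) = \<one>" for x
  proof -
    have "set (power_word ws x) \<subseteq> S"
      unfolding power_word set_append using t a b by (intro Un_least pw_S) simp_all
    then have "power_word ws x \<in> lists S" by (auto simp: in_lists_conv_set)
    moreover have "word_value G (power_word ws x) = inv t [^] x 0 \<otimes> (a [^] x 1 \<otimes> (t [^] x 2 \<otimes> tail x))"
      using pw_G t a b unfolding power_word by (simp add: pw_val tail_def del: set_concat)
    ultimately show ?thesis by (simp add: E_def word_problem_def)
  qed
  have "[] \<noteq> W g" if "g \<in> carrier G" for g using W[OF that] by auto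
  then have "[] \<notin> set ws" using t a b by (simp add: ws_def)
  then have pump: "pumpable 7 E"
    unfolding E_def len[symmetric] by (rule poly_context_free_pumpable[OF S(3)])
  have "\<exists>x. x \<in> E \<and> x 0 = n \<and> x 1 = 2 ^ n \<and> x 2 = n" for n
  proof -
    obtain z where z: "z \<in> N" "a [^] ((2 :: nat) ^ n) \<otimes> t [^] n = t [^] n \<otimes> z" using enters by blast
    obtain p p' q q' where pq: "z \<otimes> (a [^] (p :: nat) \<otimes> (inv a [^] (p' :: nat) \<otimes>
        (b [^] (q :: nat) \<otimes> inv b [^] (q' :: nat)))) = \<one>" using coords[OF z(1)] by blast
    define x where "x = (\<lambda>l. [n, 2 ^ n, n, p, p', q, q'] ! l)"
    have x: "x 0 = n" "x 1 = 2 ^ n" "x 2 = n" "x 3 = p" "x 4 = p'" "x 5 = q" "x 6 = q'"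
      by (simp_all add: x_def)
    have zt: "z \<otimes> tail x = \<one>" using pq by (simp add: tail_def x)
    have c: "tail x \<in> carrier G" "z \<in> carrier G" using tail_N NG z by auto
    have "a [^] ((2 :: nat) ^ n) \<otimes> (t [^] n \<otimes> tail x) = (a [^] ((2 :: nat) ^ n) \<otimes> t [^] n) \<otimes> tail x"
      using a t c by (simp add: m_assoc)
    also have "\<dots> = t [^] n \<otimes> (z \<otimes> tail x)" unfolding z(2) using t c by (simp add: m_assoc)
    also have "\<dots> = t [^] n" using t by (simp add: zt)
    finally have "inv t [^] n \<otimes> (a [^] ((2 :: nat) ^ n) \<otimes> (t [^] n \<otimes> tail x)) = \<one>"
      using t by (simp add: nat_pow_inv)
    then show ?thesis unfolding E using x by (intro exI[of _ x]) simp
  qed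
  then obtain X where X: "\<And>n. X n \<in> E" "\<And>n. X n 0 = n" "\<And>n. X n 1 = 2 ^ n" "\<And>n. X n 2 = n"
    by metis
  obtain \<sigma> :: "nat \<Rightarrow> nat" where \<sigma>: "strict_mono \<sigma>"
    "\<forall>i j. i < j \<longrightarrow> (\<forall>l<7. X (\<sigma> i) l \<le> X (\<sigma> j) l) \<and>
        (\<forall>k. (\<lambda>l. X (\<sigma> i) l + k * (X (\<sigma> j) l - X (\<sigma> i) l)) \<in> E)"
    using pumpableD[of 7 E X, OF pump X(1)] by (elim exE conjE) (rule that)
  define i d where "i = \<sigma> 0" and "d = \<sigma> 1 - \<sigma> 0"
  have d: "\<sigma> 1 = i + d" "d > 0" using strict_monoD[OF \<sigma>(1), of 0 1] by (auto simp: i_def d_def)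
  \<comment> \<open>Pumping twice suffices: \<open>1 + 2 (c - 1) < c\<^sup>2\<close> for \<open>c = 2\<^sup>d \<ge> 2\<close>.\<close>
  define y where "y = (\<lambda>l. X i l + 2 * (X (i + d) l - X i l))"
  have yE: "y \<in> E" using \<sigma>(2)[rule_format, of 0 1] d by (simp add: y_def i_def)
  define m where "m = 2 ^ i + 2 * (2 ^ (i + d) - 2 ^ i :: nat)"
  have y: "y 0 = i + 2 * d" "y 1 = m" "y 2 = i + 2 * d" unfolding y_def m_def X by simp_all
  have c: "tail y \<in> carrier G" using tail_N NG by auto
  have "inv t [^] (i + 2 * d) \<otimes> (a [^] m \<otimes> (t [^] (i + 2 * d) \<otimes> tail y)) = \<one>"
    using yE unfolding E y .
  then have "a [^] m \<otimes> (t [^] (i + 2 * d) \<otimes> tail y) = t [^] (i + 2 * d)"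
    using a t c by (metis inv_closed inv_inv inv_unique' l_inv m_closed nat_pow_closed nat_pow_inv r_inv inv_equality)
  then have "a [^] m \<otimes> t [^] (i + 2 * d) = t [^] (i + 2 * d) \<otimes> inv (tail y)"
    using a t c by (simp add: inv_solve_right m_assoc)
  moreover have "inv (tail y) \<in> N" using tail_N N by (simp add: subgroup.m_inv_closed)
  moreover have "m > 0" by (simp add: m_def)
  ultimately have "2 ^ (i + 2 * d) \<le> m" by (intro sparse)
  moreover have "m < 2 ^ (i + 2 * d)"
  proof -
    define c :: nat where "c = 2 ^ d"
    have "c \<ge> 2" using d(2) unfolding c_def by (metis One_nat_def Suc_leI power_increasing power_one_right one_le_numeral)
    then obtain e where e: "c = Suc (Suc e)" by (metis add_2_eq_Suc le_Suc_ex)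
    have "m = 2 ^ i * (1 + 2 * Suc e)" by (simp add: m_def power_add e algebra_simps flip: c_def)
    also have "\<dots> < 2 ^ i * (c * c)" by (intro mult_strict_left_mono) (simp_all add: e)
    also have "\<dots> = 2 ^ (i + 2 * d)" by (simp add: c_def power_add mult_2)
    finally show ?thesis .
  qed
  ultimately show False by simp
qed

lemma two_power_times_odd: "0 < (m :: nat) \<Longrightarrow> \<exists>e k. m = 2 ^ e * k \<and> odd k"
proof (induction m rule: less_induct)
  case (less m)
  show ?case
  proof (cases "odd m")
    case True
    then show ?thesis by (intro exI[of _ 0] exI[of _ m]) simp
  next
    case False
    then obtain l where l: "m = 2 * l" by auto
    then obtain e k where "l = 2 ^ e * k" "odd k" using less.IH[of l] less.prems by auto
    then show ?thesis using l by (intro exI[of _ "Suc e"] exI[of _ k]) simp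
  qed
qed

text \<open>The reduced word for \<open>(c p)\<^sup>n\<close>, along which the translations are moved.\<close>

definition zigzag :: "nat \<Rightarrow> letter list" where
  "zigzag n = concat (replicate n [Lc, Lp])"

lemma zigzag_simps [simp]: "zigzag 0 = []" "zigzag (Suc n) = Lc # Lp # zigzag n"
  by (simp_all add: zigzag_def)

lemma red_zigzag: "red (zigzag n)"
proof (induction n)
  case (Suc n)
  then show ?case by (cases n) auto
qed simp

text \<open>One passage through \<open>c p\<close> maps \<open>(i, j)\<close> to \<open>(i / 2 - j, i)\<close>. As long as \<open>j\<close> is divisible
  by a higher power of 2 than \<open>i\<close>, the first coordinate loses exactly one factor 2 and the
  shape of the pair is preserved.\<close>

lemma acts_zigzag: "odd u \<Longrightarrow> H.acts (2 ^ e * u, 2 ^ Suc e * w) (zigzag n) = zigzag n \<longleftrightarrow> n \<le> e"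
proof (induction n arbitrary: e u w)
  case (Suc n)
  show ?case
  proof (cases e)
    case 0
    then show ?thesis using Suc.prems by simp
  next
    case (Suc e')
    have "odd (u - 4 * w)" using Suc.prems by simp
    then have "H.acts (2 ^ e' * (u - 4 * w), 2 ^ Suc e' * u) (zigzag n) = zigzag n \<longleftrightarrow> n \<le> e'"
      by (rule Suc.IH)
    moreover have "2 ^ e * u div 2 - 2 ^ Suc e * w = 2 ^ e' * (u - 4 * w)" "2 ^ e * u = 2 ^ Suc e' * u"
      by (simp_all add: Suc algebra_simps)
    ultimately show ?thesis using Suc by simp
  qed
qed simp

lemma not_poly_context_free_H: "\<not> poly_context_free_group (nat_copy H.knit)"
proof -
  interpret K: group H.knit by (rule H.group_knit)
  interpret N: group "nat_copy H.knit" by (rule nat_copy_group[OF H.group_knit])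
  let ?H = "nat_copy H.knit" and ?h = "to_nat :: letter list \<times> int \<times> int \<Rightarrow> nat"
  interpret h: group_hom H.knit ?H ?h
    using nat_copy_iso[of H.knit] by unfold_locales (auto simp: iso_def)
  define t where "t = ([Lc, Lp], 0 :: int \<times> int)"
  define V where "V z = ([] :: letter list, z :: int \<times> int)" for z
  have carr: "t \<in> carrier H.knit" "V z \<in> carrier H.knit" for z
    by (simp_all add: t_def V_def H.knit_carrier)
  have V_mult: "V z \<otimes>\<^bsub>H.knit\<^esub> V w = V (z + w)" for z w by (simp add: V_def H.knit_mult)
  have V_one: "V 0 = \<one>\<^bsub>H.knit\<^esub>" by (simp add: V_def H.knit_one)
  have V_inv: "inv\<^bsub>H.knit\<^esub> (V z) = V (- z)" for z
    using carr by (intro K.inv_equality) (simp_all add: V_mult V_one)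
  have V_pow: "V (i, j) [^]\<^bsub>H.knit\<^esub> n = V (int n * i, int n * j)" for i j and n :: nat
    by (induction n) (simp_all add: V_mult V_one[unfolded zero_prod_def] algebra_simps)
  have t_pow: "t [^]\<^bsub>H.knit\<^esub> n = (zigzag n, 0)" for n :: nat
  proof (induction n)
    case 0
    then show ?case by (simp add: H.knit_one)
  next
    case (Suc n)
    have "t [^]\<^bsub>H.knit\<^esub> Suc n = t \<otimes>\<^bsub>H.knit\<^esub> (zigzag n, 0)"
      using K.nat_pow_Suc2[OF carr(1), of n] by (simp only: Suc)
    also have "\<dots> = (cat [Lc, Lp] (zigzag n), 0)"
      by (simp add: t_def H.knit_mult)
    also have "cat [Lc, Lp] (zigzag n) = zigzag (Suc n)"
      by (cases n) simp_all
    finally show ?case .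
  qed
  have commute: "V (int m, 0) \<otimes>\<^bsub>H.knit\<^esub> t [^]\<^bsub>H.knit\<^esub> n = t [^]\<^bsub>H.knit\<^esub> n \<otimes>\<^bsub>H.knit\<^esub> V z \<longleftrightarrow>
      H.acts (int m, 0) (zigzag n) = zigzag n \<and> z = H.ress (int m, 0) (zigzag n)" for m n z
    by (auto simp: t_pow V_def H.knit_mult cat_Nil[OF red_zigzag])
  have V_sub: "subgroup (range V) H.knit"
    by (rule K.subgroupI) (auto simp: carr V_inv V_mult intro: carr)
  have inj: "?h x = ?h y \<longleftrightarrow> x = y" for x y by simp
  let ?a = "?h (V (1, 0))" and ?b = "?h (V (0, 1))" and ?t = "?h t"
  show ?thesis
  proof (rule N.not_poly_context_free_groupI)
    show "?t \<in> carrier ?H" "?a \<in> carrier ?H" "?b \<in> carrier ?H"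
      using carr h.hom_closed by auto
    show "subgroup (?h ` range V) ?H" using h.subgroup_img_is_subgroup[OF V_sub] .
    show "?h (V (1, 0)) \<in> ?h ` range V" "?h (V (0, 1)) \<in> ?h ` range V" by auto
  next
    fix z assume "z \<in> ?h ` range V"
    then obtain i j where z: "z = ?h (V (i, j))" by auto
    have "V (i, j) \<otimes>\<^bsub>H.knit\<^esub> (V (1, 0) [^]\<^bsub>H.knit\<^esub> nat (- i) \<otimes>\<^bsub>H.knit\<^esub>
        (V (- 1, 0) [^]\<^bsub>H.knit\<^esub> nat i \<otimes>\<^bsub>H.knit\<^esub>
        (V (0, 1) [^]\<^bsub>H.knit\<^esub> nat (- j) \<otimes>\<^bsub>H.knit\<^esub> V (0, - 1) [^]\<^bsub>H.knit\<^esub> nat j))) = \<one>\<^bsub>H.knit\<^esub>"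
      by (simp add: V_pow V_mult flip: V_one) (simp add: zero_prod_def)
    from arg_cong[OF this, of ?h]
    have "z \<otimes>\<^bsub>?H\<^esub> (?a [^]\<^bsub>?H\<^esub> nat (- i) \<otimes>\<^bsub>?H\<^esub> (inv\<^bsub>?H\<^esub> ?a [^]\<^bsub>?H\<^esub> nat i \<otimes>\<^bsub>?H\<^esub>
        (?b [^]\<^bsub>?H\<^esub> nat (- j) \<otimes>\<^bsub>?H\<^esub> inv\<^bsub>?H\<^esub> ?b [^]\<^bsub>?H\<^esub> nat j))) = \<one>\<^bsub>?H\<^esub>"
      using carr by (simp add: z V_inv h.hom_nat_pow flip: h.hom_inv)
    then show "\<exists>p p' q q'. z \<otimes>\<^bsub>?H\<^esub> (?a [^]\<^bsub>?H\<^esub> (p :: nat) \<otimes>\<^bsub>?H\<^esub> (inv\<^bsub>?H\<^esub> ?a [^]\<^bsub>?H\<^esub> (p' :: nat) \<otimes>\<^bsub>?H\<^esub>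
        (?b [^]\<^bsub>?H\<^esub> (q :: nat) \<otimes>\<^bsub>?H\<^esub> inv\<^bsub>?H\<^esub> ?b [^]\<^bsub>?H\<^esub> (q' :: nat)))) = \<one>\<^bsub>?H\<^esub>"
      by blast
  next
    fix n :: nat
    let ?z = "H.ress (2 ^ n, 0) (zigzag n)"
    have "H.acts (2 ^ n, 0) (zigzag n) = zigzag n" using acts_zigzag[of 1 n 0 n] by simp
    then have "V (int (2 ^ n), 0) \<otimes>\<^bsub>H.knit\<^esub> t [^]\<^bsub>H.knit\<^esub> n = t [^]\<^bsub>H.knit\<^esub> n \<otimes>\<^bsub>H.knit\<^esub> V ?z"
      unfolding commute by simp
    then have "V (1, 0) [^]\<^bsub>H.knit\<^esub> ((2 :: nat) ^ n) \<otimes>\<^bsub>H.knit\<^esub> t [^]\<^bsub>H.knit\<^esub> n = t [^]\<^bsub>H.knit\<^esub> n \<otimes>\<^bsub>H.knit\<^esub> V ?z"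
      by (simp add: V_pow)
    from arg_cong[OF this, of ?h]
    have "?a [^]\<^bsub>?H\<^esub> ((2 :: nat) ^ n) \<otimes>\<^bsub>?H\<^esub> ?t [^]\<^bsub>?H\<^esub> n = ?t [^]\<^bsub>?H\<^esub> n \<otimes>\<^bsub>?H\<^esub> ?h (V ?z)"
      using carr by (simp add: h.hom_nat_pow)
    then show "\<exists>z\<in>?h ` range V. ?a [^]\<^bsub>?H\<^esub> ((2 :: nat) ^ n) \<otimes>\<^bsub>?H\<^esub> ?t [^]\<^bsub>?H\<^esub> n = ?t [^]\<^bsub>?H\<^esub> n \<otimes>\<^bsub>?H\<^esub> z"
      by blast
  next
    fix n m :: nat and z
    assume "z \<in> ?h ` range V" and m: "0 < m"
      and eq: "?a [^]\<^bsub>?H\<^esub> m \<otimes>\<^bsub>?H\<^esub> ?t [^]\<^bsub>?H\<^esub> n = ?t [^]\<^bsub>?H\<^esub> n \<otimes>\<^bsub>?H\<^esub> z"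
    then obtain z' where z: "z = ?h (V z')" by auto
    have "?h (V (1, 0) [^]\<^bsub>H.knit\<^esub> m \<otimes>\<^bsub>H.knit\<^esub> t [^]\<^bsub>H.knit\<^esub> n) = ?h (t [^]\<^bsub>H.knit\<^esub> n \<otimes>\<^bsub>H.knit\<^esub> V z')"
      using eq carr by (simp add: z h.hom_nat_pow)
    then have "V (int m, 0) \<otimes>\<^bsub>H.knit\<^esub> t [^]\<^bsub>H.knit\<^esub> n = t [^]\<^bsub>H.knit\<^esub> n \<otimes>\<^bsub>H.knit\<^esub> V z'"
      unfolding inj by (simp add: V_pow)
    then have unmoved: "H.acts (int m, 0) (zigzag n) = zigzag n" unfolding commute by blast
    obtain e k where "m = 2 ^ e * k" "odd k" using two_power_times_odd[OF m] by blast
    then have "n \<le> e" using acts_zigzag[of "int k" e 0 n] unmoved by simp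
    then have "2 ^ n \<le> (2 :: nat) ^ e" by (simp add: power_increasing)
    also have "\<dots> \<le> m" using \<open>m = 2 ^ e * k\<close> m by simp
    finally show "2 ^ n \<le> m" .
  qed
qed

theorem corollary1p1:
  "\<exists>(G :: nat monoid) (H :: nat monoid).
     group G \<and> group H \<and> finitely_generated G \<and> finitely_generated H \<and>
     quasi_isometric_groups G H \<and>
     poly_context_free_group G \<and> \<not> poly_context_free_group H"
proof -
  note groups = G.group_knit nat_copy_group[OF G.group_knit] H.group_knit nat_copy_group[OF H.group_knit]
  have "finitely_generated (nat_copy G.knit)" "finitely_generated (nat_copy H.knit)"
    using finite_generating_set_iso[OF groups(1,2) nat_copy_iso G.generating]
      finite_generating_set_iso[OF groups(3,4) nat_copy_iso H.generating]
    by (auto simp: finitely_generated_def)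
  moreover have "quasi_isometric_groups (nat_copy G.knit) (nat_copy H.knit)"
    by (rule quasi_isometric_groups_iso[OF quasi_isometric_knits groups nat_copy_iso nat_copy_iso])
  ultimately show ?thesis
    using groups poly_context_free_G not_poly_context_free_H by blast
qed

end
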